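(* Let $(M^{2n},g,J,\nabla f,\lambda)$ be a gradient Kähler-Ricci soliton of real dimension $2n\ge 4$ admitting a non-parallel closed conformal real vector field $X$. Then: (i) $X$ is homothetic and is an infinitesimal automorphism of the complex structure, i.e. $\mathcal{L}_X J=0$; (ii) $(M,g)$ is Ricci-flat, and if $2n=4$ then $(M,g)$ is flat.
   Context: Manifolds are smooth and connected. A Kähler manifold $(M,g,J)$ of real dimension $2n$ is a Riemannian manifold with a complex structure $J:TM\to TM$, $J^2=-I$, such that $g(JY,JZ)=g(Y,Z)$ for all real vector fields $Y,Z$ and $\nabla J=0$, where $\nabla$ is the Riemannian connection of $g$. A gradient Kähler-Ricci soliton is a Kähler manifold together with a smooth real function $f$ on $M$ and a real constant $\lambda$ such that $\mathrm{Ric}+\mathrm{Hess}\,f=\lambda g$. A vector field $X$ on $(M,g)$ is a closed conformal vector field if there is a smooth real function $\psi$ on $M$ (the conformal factor) with $\nabla_Y X=\psi Y$ for all vector fields $Y$. It is parallel if $\psi$ vanishes identically, non-parallel otherwise, and homothetic if $\psi$ is constant. *)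

theory Defs
  imports "HOL-Analysis.Analysis"
begin

section \<open>Smooth maps between normed spaces\<close>

primrec k_times_differentiable_on ::
  "nat \<Rightarrow> 'a::real_normed_vector set \<Rightarrow> ('a \<Rightarrow> 'b::real_normed_vector) \<Rightarrow> bool" where
  "k_times_differentiable_on 0 S F \<longleftrightarrow> continuous_on S F"
| "k_times_differentiable_on (Suc k) S F \<longleftrightarrow>
     (\<forall>x\<in>S. F differentiable (at x)) \<and>
     (\<forall>v. k_times_differentiable_on k S (\<lambda>x. frechet_derivative F (at x) v))"

text \<open>Only used for open \<open>S\<close>, where this is the class of infinitely differentiable maps.\<close>

definition smooth_on ::
  "'a::real_normed_vector set \<Rightarrow> ('a \<Rightarrow> 'b::real_normed_vector) \<Rightarrow> bool" where
  "smooth_on S F \<longleftrightarrow> (\<forall>k. k_times_differentiable_on k S F)"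


section \<open>Smooth manifolds\<close>

text \<open>A chart is a pair \<open>(U, \<phi>)\<close>; the values of \<open>\<phi>\<close> outside \<open>U\<close> are irrelevant.\<close>

type_synonym ('m, 'e) chart = "'m set \<times> ('m \<Rightarrow> 'e)"

definition chart_image :: "('m, 'e) chart \<Rightarrow> 'e set" where
  "chart_image c = snd c ` fst c"

definition chart_inv :: "('m, 'e) chart \<Rightarrow> 'e \<Rightarrow> 'm" where
  "chart_inv c = inv_into (fst c) (snd c)"

definition overlap :: "('m, 'e) chart \<Rightarrow> ('m, 'e) chart \<Rightarrow> 'e set" where
  "overlap c d = snd c ` (fst c \<inter> fst d)"

definition transition :: "('m, 'e) chart \<Rightarrow> ('m, 'e) chart \<Rightarrow> 'e \<Rightarrow> 'e" where
  "transition c d = snd d \<circ> chart_inv c"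

definition smooth_atlas ::
  "('m::topological_space, 'e::euclidean_space) chart set \<Rightarrow> bool" where
  "smooth_atlas A \<longleftrightarrow>
     (\<Union>c\<in>A. fst c) = UNIV \<and>
     (\<forall>c\<in>A. open (fst c) \<and> open (chart_image c) \<and>
        homeomorphism (fst c) (chart_image c) (snd c) (chart_inv c)) \<and>
     (\<forall>c\<in>A. \<forall>d\<in>A. smooth_on (overlap c d) (transition c d))"

definition connected_smooth_manifold ::
  "('m::{t2_space, second_countable_topology}, 'e::euclidean_space) chart set \<Rightarrow> bool" where
  "connected_smooth_manifold A \<longleftrightarrow> smooth_atlas A \<and> connected (UNIV :: 'm set)"

definition smooth_function ::
  "('m, 'e::euclidean_space) chart set \<Rightarrow> ('m \<Rightarrow> real) \<Rightarrow> bool" where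
  "smooth_function A f \<longleftrightarrow> (\<forall>c\<in>A. smooth_on (chart_image c) (f \<circ> chart_inv c))"


section \<open>Tensor fields\<close>

text \<open>
  A tensor field is the family of its local representatives, one for each chart \<open>c\<close> of the
  atlas, which are smooth on the open set \<open>chart_image c\<close> and are related by the differentials of
  the transition maps. The value of a representative outside \<open>chart_image c\<close> is irrelevant.
\<close>

type_synonym ('m, 'e) vfield = "('m, 'e) chart \<Rightarrow> 'e \<Rightarrow> 'e"
type_synonym ('m, 'e) endofield = "('m, 'e) chart \<Rightarrow> 'e \<Rightarrow> 'e \<Rightarrow> 'e"
type_synonym ('m, 'e) metric = "('m, 'e) chart \<Rightarrow> 'e \<Rightarrow> 'e \<Rightarrow> 'e \<Rightarrow> real"

definition vector_field ::
  "('m, 'e::euclidean_space) chart set \<Rightarrow> ('m, 'e) vfield \<Rightarrow> bool" where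
  "vector_field A X \<longleftrightarrow>
     (\<forall>c\<in>A. smooth_on (chart_image c) (X c)) \<and>
     (\<forall>c\<in>A. \<forall>d\<in>A. \<forall>x\<in>overlap c d.
        X d (transition c d x) = frechet_derivative (transition c d) (at x) (X c x))"

definition endomorphism_field ::
  "('m, 'e::euclidean_space) chart set \<Rightarrow> ('m, 'e) endofield \<Rightarrow> bool" where
  "endomorphism_field A J \<longleftrightarrow>
     (\<forall>c\<in>A. (\<forall>x\<in>chart_image c. linear (J c x)) \<and>
        (\<forall>v. smooth_on (chart_image c) (\<lambda>x. J c x v))) \<and>
     (\<forall>c\<in>A. \<forall>d\<in>A. \<forall>x\<in>overlap c d. \<forall>v.
        J d (transition c d x) (frechet_derivative (transition c d) (at x) v) =
        frechet_derivative (transition c d) (at x) (J c x v))"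

definition inner_form :: "('e::euclidean_space \<Rightarrow> 'e \<Rightarrow> real) \<Rightarrow> bool" where
  "inner_form b \<longleftrightarrow>
     bilinear b \<and> (\<forall>u v. b u v = b v u) \<and> (\<forall>v. v \<noteq> 0 \<longrightarrow> b v v > 0)"

definition riemannian_metric ::
  "('m, 'e::euclidean_space) chart set \<Rightarrow> ('m, 'e) metric \<Rightarrow> bool" where
  "riemannian_metric A g \<longleftrightarrow>
     (\<forall>c\<in>A. (\<forall>x\<in>chart_image c. inner_form (g c x)) \<and>
        (\<forall>u v. smooth_on (chart_image c) (\<lambda>x. g c x u v))) \<and>
     (\<forall>c\<in>A. \<forall>d\<in>A. \<forall>x\<in>overlap c d. \<forall>u v.
        g d (transition c d x) (frechet_derivative (transition c d) (at x) u)
          (frechet_derivative (transition c d) (at x) v) = g c x u v)"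


section \<open>Riemannian geometry in a chart\<close>

text \<open>
  In this section \<open>h :: 'e \<Rightarrow> 'e \<Rightarrow> 'e \<Rightarrow> real\<close> is the representative of a metric in one chart
  and \<open>\<lambda>_. v\<close> is the coordinate vector field with constant components \<open>v\<close>.
  \<open>christoffel h x u v\<close> is the value at \<open>x\<close> of the covariant derivative of \<open>\<lambda>_. v\<close> along \<open>u\<close>; it
  is determined by the connection being torsion-free (symmetry, as coordinate fields commute) and
  compatible with the metric.
\<close>

definition levi_civita_at ::
  "('e::euclidean_space \<Rightarrow> 'e \<Rightarrow> 'e \<Rightarrow> real) \<Rightarrow> 'e \<Rightarrow> ('e \<Rightarrow> 'e \<Rightarrow> 'e) \<Rightarrow> bool" where
  "levi_civita_at h x \<Gamma> \<longleftrightarrow>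
     bilinear \<Gamma> \<and> (\<forall>u v. \<Gamma> u v = \<Gamma> v u) \<and>
     (\<forall>u v w. frechet_derivative (\<lambda>y. h y v w) (at x) u = h x (\<Gamma> u v) w + h x v (\<Gamma> u w))"

definition christoffel ::
  "('e::euclidean_space \<Rightarrow> 'e \<Rightarrow> 'e \<Rightarrow> real) \<Rightarrow> 'e \<Rightarrow> 'e \<Rightarrow> 'e \<Rightarrow> 'e" where
  "christoffel h x = (THE \<Gamma>. levi_civita_at h x \<Gamma>)"

definition cov_deriv ::
  "('e::euclidean_space \<Rightarrow> 'e \<Rightarrow> 'e \<Rightarrow> real) \<Rightarrow> ('e \<Rightarrow> 'e) \<Rightarrow> ('e \<Rightarrow> 'e) \<Rightarrow> 'e \<Rightarrow> 'e" where
  "cov_deriv h Y X x = frechet_derivative X (at x) (Y x) + christoffel h x (Y x) (X x)"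

definition lie_bracket ::
  "('e::euclidean_space \<Rightarrow> 'e) \<Rightarrow> ('e \<Rightarrow> 'e) \<Rightarrow> 'e \<Rightarrow> 'e" where
  "lie_bracket X Y x = frechet_derivative Y (at x) (X x) - frechet_derivative X (at x) (Y x)"

text \<open>
  The following expressions are tensorial in the vector arguments, so they may be evaluated on the
  coordinate fields extending these vectors.
\<close>

definition curvature ::
  "('e::euclidean_space \<Rightarrow> 'e \<Rightarrow> 'e \<Rightarrow> real) \<Rightarrow> 'e \<Rightarrow> 'e \<Rightarrow> 'e \<Rightarrow> 'e \<Rightarrow> 'e" where
  "curvature h x u v w =
     (let U = (\<lambda>_. u); V = (\<lambda>_. v); W = (\<lambda>_. w) in
        cov_deriv h U (cov_deriv h V W) x - cov_deriv h V (cov_deriv h U W) x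
          - cov_deriv h (lie_bracket U V) W x)"

definition ricci ::
  "(real^'k \<Rightarrow> real^'k \<Rightarrow> real^'k \<Rightarrow> real) \<Rightarrow> real^'k \<Rightarrow> real^'k \<Rightarrow> real^'k \<Rightarrow> real" where
  "ricci h x v w = trace (matrix (\<lambda>u. curvature h x u v w))"

definition hessian ::
  "('e::euclidean_space \<Rightarrow> 'e \<Rightarrow> 'e \<Rightarrow> real) \<Rightarrow> ('e \<Rightarrow> real) \<Rightarrow> 'e \<Rightarrow> 'e \<Rightarrow> 'e \<Rightarrow> real" where
  "hessian h F x u v =
     frechet_derivative (\<lambda>y. frechet_derivative F (at y) v) (at x) u
       - frechet_derivative F (at x) (cov_deriv h (\<lambda>_. u) (\<lambda>_. v) x)"

definition cov_deriv_endo ::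
  "('e::euclidean_space \<Rightarrow> 'e \<Rightarrow> 'e \<Rightarrow> real) \<Rightarrow> ('e \<Rightarrow> 'e \<Rightarrow> 'e) \<Rightarrow> 'e \<Rightarrow> 'e \<Rightarrow> 'e \<Rightarrow> 'e" where
  "cov_deriv_endo h K x u v =
     cov_deriv h (\<lambda>_. u) (\<lambda>y. K y v) x - K x (cov_deriv h (\<lambda>_. u) (\<lambda>_. v) x)"

definition lie_deriv_endo ::
  "('e::euclidean_space \<Rightarrow> 'e) \<Rightarrow> ('e \<Rightarrow> 'e \<Rightarrow> 'e) \<Rightarrow> 'e \<Rightarrow> 'e \<Rightarrow> 'e" where
  "lie_deriv_endo X K x v = lie_bracket X (\<lambda>y. K y v) x - K x (lie_bracket X (\<lambda>_. v) x)"


section \<open>Kaehler manifolds and gradient solitons\<close>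

definition kaehler ::
  "('m, 'e::euclidean_space) chart set \<Rightarrow> ('m, 'e) metric \<Rightarrow> ('m, 'e) endofield \<Rightarrow> bool" where
  "kaehler A g J \<longleftrightarrow>
     riemannian_metric A g \<and> endomorphism_field A J \<and>
     (\<forall>c\<in>A. \<forall>x\<in>chart_image c.
        (\<forall>v. J c x (J c x v) = - v) \<and>
        (\<forall>u v. g c x (J c x u) (J c x v) = g c x u v) \<and>
        (\<forall>u v. cov_deriv_endo (g c) (J c) x u v = 0))"

definition gradient_kaehler_ricci_soliton ::
  "('m, real^'k) chart set \<Rightarrow> ('m, real^'k) metric \<Rightarrow> ('m, real^'k) endofield \<Rightarrow>
    ('m \<Rightarrow> real) \<Rightarrow> real \<Rightarrow> bool" where
  "gradient_kaehler_ricci_soliton A g J f lam \<longleftrightarrow>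
     kaehler A g J \<and> smooth_function A f \<and>
     (\<forall>c\<in>A. \<forall>x\<in>chart_image c. \<forall>u v.
        ricci (g c) x u v + hessian (g c) (f \<circ> chart_inv c) x u v = lam * g c x u v)"

definition ricci_flat :: "('m, real^'k) chart set \<Rightarrow> ('m, real^'k) metric \<Rightarrow> bool" where
  "ricci_flat A g \<longleftrightarrow> (\<forall>c\<in>A. \<forall>x\<in>chart_image c. \<forall>u v. ricci (g c) x u v = 0)"

definition flat ::
  "('m, 'e::euclidean_space) chart set \<Rightarrow> ('m, 'e) metric \<Rightarrow> bool" where
  "flat A g \<longleftrightarrow> (\<forall>c\<in>A. \<forall>x\<in>chart_image c. \<forall>u v w. curvature (g c) x u v w = 0)"


section \<open>Closed conformal vector fields\<close>

definition conformal_factor ::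
  "('m, 'e::euclidean_space) chart set \<Rightarrow> ('m, 'e) metric \<Rightarrow> ('m, 'e) vfield \<Rightarrow>
    ('m \<Rightarrow> real) \<Rightarrow> bool" where
  "conformal_factor A g X \<psi> \<longleftrightarrow>
     smooth_function A \<psi> \<and>
     (\<forall>c\<in>A. \<forall>x\<in>chart_image c. \<forall>v.
        cov_deriv (g c) (\<lambda>_. v) (X c) x = \<psi> (chart_inv c x) *\<^sub>R v)"

definition closed_conformal ::
  "('m, 'e::euclidean_space) chart set \<Rightarrow> ('m, 'e) metric \<Rightarrow> ('m, 'e) vfield \<Rightarrow> bool" where
  "closed_conformal A g X \<longleftrightarrow> vector_field A X \<and> (\<exists>\<psi>. conformal_factor A g X \<psi>)"

definition parallel_field ::
  "('m, 'e::euclidean_space) chart set \<Rightarrow> ('m, 'e) metric \<Rightarrow> ('m, 'e) vfield \<Rightarrow> bool" where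
  "parallel_field A g X \<longleftrightarrow>
     vector_field A X \<and> (\<exists>\<psi>. conformal_factor A g X \<psi> \<and> (\<forall>p. \<psi> p = 0))"

definition homothetic ::
  "('m, 'e::euclidean_space) chart set \<Rightarrow> ('m, 'e) metric \<Rightarrow> ('m, 'e) vfield \<Rightarrow> bool" where
  "homothetic A g X \<longleftrightarrow>
     vector_field A X \<and> (\<exists>\<psi>. conformal_factor A g X \<psi> \<and> (\<exists>a. \<forall>p. \<psi> p = a))"

definition infinitesimal_automorphism ::
  "('m, 'e::euclidean_space) chart set \<Rightarrow> ('m, 'e) endofield \<Rightarrow> ('m, 'e) vfield \<Rightarrow> bool" where
  "infinitesimal_automorphism A J X \<longleftrightarrow>
     (\<forall>c\<in>A. \<forall>x\<in>chart_image c. \<forall>v. lie_deriv_endo (X c) (J c) x v = 0)"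


section \<open>The Levi-Civita connection is well defined\<close>

lemma inner_form_nondegenerate:
  assumes "inner_form b" "\<And>w. b z w = b z' w"
  shows "z = z'"
proof (rule ccontr)
  assume "z \<noteq> z'"
  then have "b (z - z') (z - z') > 0"
    using assms(1) by (simp add: inner_form_def)
  moreover have "b (z - z') (z - z') = b z (z - z') - b z' (z - z')"
    using assms(1) by (intro bilinear_lsub) (simp add: inner_form_def)
  ultimately show False
    using assms(2) by simp
qed

lemma inner_form_represents:
  fixes l :: "'e::euclidean_space \<Rightarrow> real"
  assumes b: "inner_form b" and l: "linear l"
  shows "\<exists>z. \<forall>w. b z w = l w"
proof -
  have bil: "bilinear b" using b by (simp add: inner_form_def)
  then have lin1: "linear (\<lambda>z. b z w)" and lin2: "linear (b z)" for z w
    by (simp_all add: bilinear_def)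
  define T where "T z = (\<Sum>i\<in>Basis. b z i *\<^sub>R i)" for z
  have T_inner: "T z \<bullet> i = b z i" if "i \<in> Basis" for z i
    using that by (simp add: T_def)
  have "linear T"
    unfolding T_def
    by (rule linearI) (simp_all add: bil bilinear_ladd bilinear_lmul scaleR_add_left
        sum.distrib scaleR_sum_right)
  moreover have "inj T"
  proof (rule injI)
    fix z z' assume "T z = T z'"
    then have "b z i = b z' i" if "i \<in> Basis" for i
      using T_inner that by metis
    then have "b z = b z'"
      by (rule linear_eq_stdbasis[OF lin2 lin2])
    then show "z = z'"
      by (intro inner_form_nondegenerate[OF b]) simp
  qed
  ultimately have "surj T"
    by (rule linear_injective_imp_surjective) simp
  then obtain z where "T z = (\<Sum>i\<in>Basis. l i *\<^sub>R i)"
    by (metis surjD)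
  then have "b z i = l i" if "i \<in> Basis" for i
    using T_inner[OF that, of z] that by simp
  then have "b z = l"
    by (rule linear_eq_stdbasis[OF lin2 l])
  then show ?thesis by auto
qed

lemma levi_civita_at_koszul:
  assumes "inner_form (h x)" "levi_civita_at h x \<Gamma>"
    and sym: "\<And>y u v. y \<in> S \<Longrightarrow> h y u v = h y v u" and S: "open S" "x \<in> S"
  shows "2 * h x (\<Gamma> u v) w =
     frechet_derivative (\<lambda>y. h y v w) (at x) u + frechet_derivative (\<lambda>y. h y u w) (at x) v
       - frechet_derivative (\<lambda>y. h y u v) (at x) w"
proof -
  have s: "h x p q = h x q p" for p q
    by (rule sym[OF S(2)])
  note lc = assms(2)[unfolded levi_civita_at_def]
  have t: "\<Gamma> p q = \<Gamma> q p" for p q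
    by (rule lc[THEN conjunct2, THEN conjunct1, rule_format])
  have c: "frechet_derivative (\<lambda>y. h y q r) (at x) p = h x (\<Gamma> p q) r + h x q (\<Gamma> p r)" for p q r
    by (rule lc[THEN conjunct2, THEN conjunct2, rule_format])
  show ?thesis
    unfolding c
    using s[of v "\<Gamma> u w"] s[of u "\<Gamma> v w"] t[of v u] t[of w u] t[of w v] by simp
qed

lemma frechet_derivative_form_linear:
  fixes h :: "'e::euclidean_space \<Rightarrow> 'e \<Rightarrow> 'e \<Rightarrow> real"
  assumes S: "open S" "x \<in> S"
    and b: "\<And>y. y \<in> S \<Longrightarrow> bilinear (h y)"
    and d: "\<And>u v. (\<lambda>y. h y u v) differentiable (at x)"
  shows "frechet_derivative (\<lambda>y. h y (a *\<^sub>R u + u') v) (at x) w =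
           a * frechet_derivative (\<lambda>y. h y u v) (at x) w
             + frechet_derivative (\<lambda>y. h y u' v) (at x) w"
proof -
  have e: "((\<lambda>y. h y u v) has_derivative frechet_derivative (\<lambda>y. h y u v) (at x)) (at x)" for u v
    using d frechet_derivative_works by blast
  have "((\<lambda>y. a * h y u v + h y u' v) has_derivative
      (\<lambda>w. a * frechet_derivative (\<lambda>y. h y u v) (at x) w
             + frechet_derivative (\<lambda>y. h y u' v) (at x) w)) (at x)"
    by (intro derivative_intros e)
  then have "((\<lambda>y. h y (a *\<^sub>R u + u') v) has_derivative
      (\<lambda>w. a * frechet_derivative (\<lambda>y. h y u v) (at x) w
             + frechet_derivative (\<lambda>y. h y u' v) (at x) w)) (at x)"
    by (rule has_derivative_transform_within_open[OF _ S])
      (simp add: b bilinear_ladd bilinear_lmul)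
  from fun_cong[OF frechet_derivative_at[OF this], of w] show ?thesis
    by simp
qed

lemma levi_civita_at_ex1:
  fixes h :: "'e::euclidean_space \<Rightarrow> 'e \<Rightarrow> 'e \<Rightarrow> real"
  assumes S: "open S" "x \<in> S"
    and h: "\<And>y. y \<in> S \<Longrightarrow> inner_form (h y)"
    and d: "\<And>u v. (\<lambda>y. h y u v) differentiable (at x)"
  shows "\<exists>!\<Gamma>. levi_civita_at h x \<Gamma>"
proof -
  define D where "D u v w = frechet_derivative (\<lambda>y. h y v w) (at x) u" for u v w
  define K where "K u v w = (D u v w + D v u w - D w u v) / 2" for u v w
  have hx: "inner_form (h x)" using h S by blast
  have bil: "bilinear (h y)" if "y \<in> S" for y
    using h[OF that] by (simp add: inner_form_def)
  have sym: "h y u v = h y v u" if "y \<in> S" for y u v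
    using h[OF that] by (simp add: inner_form_def)
  have Dsym: "D u v w = D u w v" for u v w
  proof -
    have "frechet_derivative (\<lambda>y. h y v w) (at x) = frechet_derivative (\<lambda>y. h y w v) (at x)"
      by (rule frechet_derivative_transform_within_open[OF d S]) (rule sym)
    then show ?thesis
      by (simp add: D_def)
  qed
  have D1: "D (a *\<^sub>R u + u') v w = a * D u v w + D u' v w" for a u u' v w
  proof -
    have "linear (frechet_derivative (\<lambda>y. h y v w) (at x))"
      using d by (rule linear_frechet_derivative)
    then show ?thesis
      by (simp add: D_def linear_add linear_cmul)
  qed
  have D2: "D w (a *\<^sub>R u + u') v = a * D w u v + D w u' v" for a u u' v w
    unfolding D_def by (rule frechet_derivative_form_linear[OF S bil d])
  have D3: "D w v (a *\<^sub>R u + u') = a * D w v u + D w v u'" for a u u' v w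
    by (simp only: Dsym[of w v] D2)
  have linK: "linear (K u v)" for u v
  proof (rule linearI)
    show "K u v (p + q) = K u v p + K u v q" for p q
      using D1[of 1 p q] D3[of _ _ 1 p q] by (simp add: K_def field_simps)
    have D0: "D 0 p q = 0" "D p q 0 = 0" for p q
      using D1[of 1 0 0 p q] D3[of p q 1 0 0] by auto
    show "K u v (a *\<^sub>R p) = a *\<^sub>R K u v p" for a p
      using D1[of a p 0] D3[of _ _ a p 0] by (simp add: K_def D0 field_simps)
  qed
  define \<Gamma> where "\<Gamma> u v = (SOME z. \<forall>w. h x z w = K u v w)" for u v
  have \<Gamma>: "h x (\<Gamma> u v) w = K u v w" for u v w
    using someI_ex[OF inner_form_represents[OF hx linK[of u v]]] by (simp add: \<Gamma>_def)
  have eqI: "z = z'" if "\<And>w. h x z w = h x z' w" for z z'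
    using inner_form_nondegenerate[OF hx that] .
  have bx: "bilinear (h x)" using bil S by blast
  have \<Gamma>sym: "\<Gamma> u v = \<Gamma> v u" for u v
  proof (rule eqI)
    show "h x (\<Gamma> u v) w = h x (\<Gamma> v u) w" for w
      by (simp only: \<Gamma> K_def Dsym[of w u v] add.commute[of "D u v w"])
  qed
  have \<Gamma>lin: "linear (\<lambda>u. \<Gamma> u v)" for v
  proof -
    have *: "\<Gamma> (a *\<^sub>R u + u') v = a *\<^sub>R \<Gamma> u v + \<Gamma> u' v" for a u u'
    proof (rule eqI)
      fix w
      have "K (a *\<^sub>R u + u') v w = a * K u v w + K u' v w"
        unfolding K_def D1 D2 D3 by argo
      then show "h x (\<Gamma> (a *\<^sub>R u + u') v) w = h x (a *\<^sub>R \<Gamma> u v + \<Gamma> u' v) w"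
        by (simp only: bilinear_ladd[OF bx] bilinear_lmul[OF bx] \<Gamma>) simp
    qed
    have zero: "\<Gamma> 0 v = 0"
      using *[of 1 0 0] by simp
    show ?thesis
    proof (rule linearI)
      show "\<Gamma> (p + q) v = \<Gamma> p v + \<Gamma> q v" for p q
        using *[of 1 p q] by simp
      show "\<Gamma> (a *\<^sub>R p) v = a *\<^sub>R \<Gamma> p v" for a p
        using *[of a p 0] zero by simp
    qed
  qed
  have "linear (\<Gamma> u)" for u
  proof -
    have "(\<lambda>v. \<Gamma> v u) = \<Gamma> u"
      by (rule ext) (rule \<Gamma>sym)
    then show ?thesis
      by (rule subst) (rule \<Gamma>lin)
  qed
  then have "bilinear \<Gamma>"
    unfolding bilinear_def using \<Gamma>lin by blast
  moreover have "D u v w = h x (\<Gamma> u v) w + h x v (\<Gamma> u w)" for u v w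
    unfolding sym[OF S(2), of v "\<Gamma> u w"] \<Gamma> K_def Dsym[of u w v]
    by (simp add: field_simps)
  ultimately have "levi_civita_at h x \<Gamma>"
    unfolding levi_civita_at_def D_def by (intro conjI allI \<Gamma>sym)
  moreover have "\<Gamma>' = \<Gamma>" if "levi_civita_at h x \<Gamma>'" for \<Gamma>'
  proof (intro ext eqI)
    fix u v w
    have "2 * h x (\<Gamma>' u v) w = 2 * K u v w"
      using levi_civita_at_koszul[OF hx that sym S] by (simp add: K_def D_def)
    then show "h x (\<Gamma>' u v) w = h x (\<Gamma> u v) w"
      by (simp add: \<Gamma>)
  qed
  ultimately show ?thesis by blast
qed

end

theory Submission
  imports Defs
begin

text \<open>
  All computations take place in one chart, with the Christoffel map of the metric; only the step
  from a locally constant to a constant conformal factor uses the manifold.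

  \<^emph>\<open>The conformal factor.\<close> If \<open>\<nabla>\<^sub>Y X = \<psi> Y\<close>, the Ricci identity gives
  \<open>R(u,v)X = d\<psi>(u) v - d\<psi>(v) u\<close> (\<open>Rm_X\<close>). On a Kaehler manifold \<open>R(Ju,Jv) = R(u,v)\<close> (\<open>Rm_J_J\<close>).
  Taking \<open>v\<close> orthogonal to \<open>u\<close> and \<open>Ju\<close>, which is possible in real dimension at least 4, these two
  facts give \<open>d\<psi> = 0\<close> (\<open>dir_deriv_factor_zero\<close>). So \<open>\<psi>\<close> is a constant \<open>a\<close>, nonzero because \<open>X\<close> is
  not parallel, and \<open>L\<^sub>X J = 0\<close> follows from \<open>\<nabla>J = 0\<close> and \<open>\<nabla>X = a I\<close>.

  \<^emph>\<open>Ricci-flatness.\<close> Now \<open>R\<close> vanishes as soon as one of its arguments is \<open>X\<close>. The second Bianchi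
  identity then gives \<open>\<nabla>\<^sub>X R = -2a R\<close>, hence \<open>\<nabla>\<^sub>X Ric = -2a Ric\<close> (\<open>nabla_X_Ric\<close>). On the other hand
  the soliton equation and the Ricci identity for \<open>df\<close> give
  \<open>(\<nabla>\<^sub>u Ric)(v,w) - (\<nabla>\<^sub>v Ric)(u,w) = df(R(u,v)w)\<close>. For \<open>u = X\<close> the right-hand side is zero, and
  differentiating \<open>Ric(X,w) = 0\<close> yields \<open>(\<nabla>\<^sub>v Ric)(X,w) = -a Ric(v,w)\<close>; so also
  \<open>\<nabla>\<^sub>X Ric = -a Ric\<close>. As \<open>a \<noteq> 0\<close>, \<open>Ric = 0\<close> (\<open>soliton_Ric_zero\<close>).

  \<^emph>\<open>Dimension four.\<close> Where \<open>X \<noteq> 0\<close>, choose \<open>Y \<noteq> 0\<close> orthogonal to \<open>X\<close> and \<open>JX\<close>. All components of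
  \<open>R\<close> involving \<open>X\<close> or \<open>JX\<close> vanish, and \<open>Ric(JY,JY) = 0\<close> forces \<open>R(Y,JY)JY = 0\<close>, hence also
  \<open>R(Y,JY)Y = 0\<close> by applying \<open>J\<close>. Since \<open>\<nabla>X = a I\<close> with \<open>a \<noteq> 0\<close>, the zeros of \<open>X\<close> have no
  interior, and \<open>R = 0\<close> everywhere by continuity (\<open>Rm_zero\<close>).
\<close>


section \<open>Smooth maps\<close>

text \<open>The derivative of \<open>F\<close> at \<open>x\<close> in the direction \<open>u\<close>.\<close>

abbreviation dir_deriv ::
  "('a::real_normed_vector \<Rightarrow> 'b::real_normed_vector) \<Rightarrow> 'a \<Rightarrow> 'a \<Rightarrow> 'b" where
  "dir_deriv F x u \<equiv> frechet_derivative F (at x) u"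

lemma dir_deriv_eqI: "(F has_derivative F') (at x) \<Longrightarrow> dir_deriv F x u = F' u"
  by (metis frechet_derivative_at)

lemma has_derivative_cong_open:
  assumes "open S" "x \<in> S" "\<And>y. y \<in> S \<Longrightarrow> F y = G y"
  shows "(F has_derivative F') (at x) \<longleftrightarrow> (G has_derivative F') (at x)"
proof
  assume "(F has_derivative F') (at x)"
  then show "(G has_derivative F') (at x)"
    by (rule has_derivative_transform_within_open[OF _ assms])
next
  assume "(G has_derivative F') (at x)"
  then show "(F has_derivative F') (at x)"
    by (rule has_derivative_transform_within_open[OF _ assms(1,2)]) (rule assms(3)[symmetric])
qed

lemma dir_deriv_cong:
  assumes "open S" "x \<in> S" "\<And>y. y \<in> S \<Longrightarrow> F y = G y"
  shows "dir_deriv F x u = dir_deriv G x u"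
proof -
  have "(F has_derivative F') (at x) \<longleftrightarrow> (G has_derivative F') (at x)" for F'
    using assms by (rule has_derivative_cong_open)
  then show ?thesis by (simp add: frechet_derivative_def)
qed

lemma differentiable_cong_open:
  assumes "open S" "x \<in> S" "\<And>y. y \<in> S \<Longrightarrow> F y = G y"
  shows "F differentiable (at x) \<longleftrightarrow> G differentiable (at x)"
proof -
  have "(F has_derivative F') (at x) \<longleftrightarrow> (G has_derivative F') (at x)" for F'
    using assms by (rule has_derivative_cong_open)
  then show ?thesis by (simp add: differentiable_def)
qed

lemma k_times_differentiable_on_cong:
  assumes "open S" "\<And>y. y \<in> S \<Longrightarrow> F y = G y"
  shows "k_times_differentiable_on k S F \<longleftrightarrow> k_times_differentiable_on k S G"
  using assms(2)
proof (induction k arbitrary: F G)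
  case 0
  show ?case
    unfolding k_times_differentiable_on.simps by (rule continuous_on_cong[OF refl 0])
next
  case (Suc k)
  have "k_times_differentiable_on k S (\<lambda>x. dir_deriv F x v) \<longleftrightarrow>
        k_times_differentiable_on k S (\<lambda>x. dir_deriv G x v)" for v
    by (rule Suc.IH) (rule dir_deriv_cong[OF assms(1) _ Suc.prems])
  moreover have "(\<forall>x\<in>S. F differentiable (at x)) \<longleftrightarrow> (\<forall>x\<in>S. G differentiable (at x))"
    using differentiable_cong_open[of S _ F G, OF assms(1) _ Suc.prems] by blast
  ultimately show ?case by simp
qed

lemma k_times_differentiable_on_Suc_imp:
  "k_times_differentiable_on (Suc k) S F \<Longrightarrow> k_times_differentiable_on k S F"
proof (induction k arbitrary: F)
  case 0
  then show ?case
    by (simp add: continuous_at_imp_continuous_on differentiable_imp_continuous_within)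
next
  case (Suc k)
  then show ?case by (metis k_times_differentiable_on.simps(2))
qed

lemma k_times_differentiable_on_const [simp]: "k_times_differentiable_on k S (\<lambda>_. c)"
  by (induction k arbitrary: c) auto

lemma k_times_differentiable_on_add:
  assumes "open S" "k_times_differentiable_on k S F" "k_times_differentiable_on k S G"
  shows "k_times_differentiable_on k S (\<lambda>x. F x + G x)"
  using assms(2,3)
proof (induction k arbitrary: F G)
  case 0
  then show ?case by (simp add: continuous_on_add)
next
  case (Suc k)
  have "k_times_differentiable_on k S (\<lambda>x. dir_deriv (\<lambda>x. F x + G x) x v)" for v
  proof (subst k_times_differentiable_on_cong[OF assms(1)])
    show "dir_deriv (\<lambda>x. F x + G x) y v = dir_deriv F y v + dir_deriv G y v" if "y \<in> S" for y
      using Suc.prems that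
      by (intro dir_deriv_eqI has_derivative_add) (simp_all add: frechet_derivative_works)
  qed (use Suc in simp)
  then show ?case using Suc.prems by (simp add: differentiable_add)
qed

lemma k_times_differentiable_on_bounded_linear:
  assumes "open S" "bounded_linear L" "k_times_differentiable_on k S F"
  shows "k_times_differentiable_on k S (\<lambda>x. L (F x))"
  using assms(3)
proof (induction k arbitrary: F)
  case 0
  then show ?case by (simp add: bounded_linear.continuous_on[OF assms(2)])
next
  case (Suc k)
  have d: "((\<lambda>x. L (F x)) has_derivative (\<lambda>v. L (dir_deriv F y v))) (at y)" if "y \<in> S" for y
    using Suc.prems that
    by (intro bounded_linear.has_derivative[OF assms(2)]) (simp add: frechet_derivative_works)
  have "k_times_differentiable_on k S (\<lambda>x. dir_deriv (\<lambda>x. L (F x)) x v)" for v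
    by (subst k_times_differentiable_on_cong[OF assms(1) dir_deriv_eqI[OF d]])
      (use Suc in simp_all)
  moreover have "\<forall>x\<in>S. (\<lambda>x. L (F x)) differentiable (at x)"
    using d differentiable_def by blast
  ultimately show ?case by simp
qed

lemma k_times_differentiable_on_bounded_bilinear:
  assumes "open S" "bounded_bilinear B"
    and "k_times_differentiable_on k S F" "k_times_differentiable_on k S G"
  shows "k_times_differentiable_on k S (\<lambda>x. B (F x) (G x))"
  using assms(3,4)
proof (induction k arbitrary: F G)
  case 0
  then show ?case by (simp add: bounded_bilinear.continuous_on[OF assms(2)])
next
  case (Suc k)
  have d: "((\<lambda>x. B (F x) (G x)) has_derivative
      (\<lambda>v. B (F y) (dir_deriv G y v) + B (dir_deriv F y v) (G y))) (at y)" if "y \<in> S" for y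
    using Suc.prems that
    by (intro bounded_bilinear.FDERIV[OF assms(2)]) (simp_all add: frechet_derivative_works)
  have "k_times_differentiable_on k S (\<lambda>x. dir_deriv (\<lambda>x. B (F x) (G x)) x v)" for v
    by (subst k_times_differentiable_on_cong[OF assms(1) dir_deriv_eqI[OF d]])
      (use Suc k_times_differentiable_on_Suc_imp[OF Suc.prems(1)]
        k_times_differentiable_on_Suc_imp[OF Suc.prems(2)] in
        \<open>simp_all add: k_times_differentiable_on_add[OF assms(1)]\<close>)
  moreover have "\<forall>x\<in>S. (\<lambda>x. B (F x) (G x)) differentiable (at x)"
    using d differentiable_def by blast
  ultimately show ?case by simp
qed

lemma k_times_differentiable_on_inverse:
  fixes F :: "'a::real_normed_vector \<Rightarrow> real"
  assumes "open S" "\<And>x. x \<in> S \<Longrightarrow> F x \<noteq> 0" "k_times_differentiable_on k S F"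
  shows "k_times_differentiable_on k S (\<lambda>x. inverse (F x))"
  using assms(3)
proof (induction k)
  case 0
  then show ?case using assms(2) by (simp add: continuous_on_inverse)
next
  case (Suc k)
  have d: "((\<lambda>x. inverse (F x)) has_derivative
      (\<lambda>v. - (inverse (F y) * dir_deriv F y v * inverse (F y)))) (at y)" if "y \<in> S" for y
    using Suc.prems that assms(2)
    by (intro Deriv.has_derivative_inverse) (simp_all add: frechet_derivative_works)
  have i: "k_times_differentiable_on k S (\<lambda>x. inverse (F x))"
    by (rule Suc.IH[OF k_times_differentiable_on_Suc_imp[OF Suc.prems]])
  have "k_times_differentiable_on k S
      (\<lambda>y. - (inverse (F y) * dir_deriv F y v * inverse (F y)))" for v
    using Suc.prems
    by (intro k_times_differentiable_on_bounded_linear[OF assms(1) bounded_linear_minus]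
        k_times_differentiable_on_bounded_bilinear[OF assms(1) bounded_bilinear_mult] i)
      (auto intro: bounded_linear_intros)
  then have "k_times_differentiable_on k S (\<lambda>x. dir_deriv (\<lambda>x. inverse (F x)) x v)" for v
    by (subst k_times_differentiable_on_cong[OF assms(1) dir_deriv_eqI[OF d]]) simp_all
  moreover have "\<forall>x\<in>S. (\<lambda>x. inverse (F x)) differentiable (at x)"
    using d differentiable_def by blast
  ultimately show ?case by simp
qed

lemma smooth_on_cong:
  "open S \<Longrightarrow> (\<And>y. y \<in> S \<Longrightarrow> F y = G y) \<Longrightarrow> smooth_on S F \<longleftrightarrow> smooth_on S G"
  unfolding smooth_on_def using k_times_differentiable_on_cong by metis

lemma smooth_on_differentiable: "smooth_on S F \<Longrightarrow> x \<in> S \<Longrightarrow> F differentiable (at x)"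
  unfolding smooth_on_def by (metis k_times_differentiable_on.simps(2))

lemma smooth_on_has_derivative:
  "smooth_on S F \<Longrightarrow> x \<in> S \<Longrightarrow> (F has_derivative dir_deriv F x) (at x)"
  using smooth_on_differentiable frechet_derivative_works by blast

lemma smooth_on_dir_deriv: "smooth_on S F \<Longrightarrow> smooth_on S (\<lambda>x. dir_deriv F x v)"
  unfolding smooth_on_def by (metis k_times_differentiable_on.simps(2))

lemma smooth_on_continuous_on: "smooth_on S F \<Longrightarrow> continuous_on S F"
  unfolding smooth_on_def by (metis k_times_differentiable_on.simps(1))

lemma smooth_on_linear_dir_deriv: "smooth_on S F \<Longrightarrow> x \<in> S \<Longrightarrow> linear (dir_deriv F x)"
  using smooth_on_differentiable linear_frechet_derivative by blast

lemma smooth_on_const: "smooth_on S (\<lambda>_. c)"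
  by (simp add: smooth_on_def)

lemma smooth_on_add:
  "open S \<Longrightarrow> smooth_on S F \<Longrightarrow> smooth_on S G \<Longrightarrow> smooth_on S (\<lambda>x. F x + G x)"
  by (simp add: smooth_on_def k_times_differentiable_on_add)

lemma smooth_on_bounded_linear:
  "open S \<Longrightarrow> bounded_linear L \<Longrightarrow> smooth_on S F \<Longrightarrow> smooth_on S (\<lambda>x. L (F x))"
  by (simp add: smooth_on_def k_times_differentiable_on_bounded_linear)

lemma smooth_on_bounded_bilinear:
  "open S \<Longrightarrow> bounded_bilinear B \<Longrightarrow> smooth_on S F \<Longrightarrow> smooth_on S G \<Longrightarrow>
    smooth_on S (\<lambda>x. B (F x) (G x))"
  by (simp add: smooth_on_def k_times_differentiable_on_bounded_bilinear)

lemmas smooth_on_scaleR = smooth_on_bounded_bilinear[OF _ bounded_bilinear_scaleR]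
lemmas smooth_on_mult = smooth_on_bounded_bilinear[OF _ bounded_bilinear_mult]

lemma smooth_on_inverse:
  fixes F :: "'a::real_normed_vector \<Rightarrow> real"
  shows "open S \<Longrightarrow> (\<And>x. x \<in> S \<Longrightarrow> F x \<noteq> 0) \<Longrightarrow> smooth_on S F \<Longrightarrow> smooth_on S (\<lambda>x. inverse (F x))"
  by (simp add: smooth_on_def k_times_differentiable_on_inverse)

lemma smooth_on_minus: "open S \<Longrightarrow> smooth_on S F \<Longrightarrow> smooth_on S (\<lambda>x. - F x)"
  by (rule smooth_on_bounded_linear[OF _ bounded_linear_minus[OF bounded_linear_ident]])

lemma smooth_on_diff:
  "open S \<Longrightarrow> smooth_on S F \<Longrightarrow> smooth_on S G \<Longrightarrow> smooth_on S (\<lambda>x. F x - G x)"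
  using smooth_on_add[of S F "\<lambda>x. - G x"] smooth_on_minus[of S G] by simp

lemma smooth_on_sum:
  assumes "open S" "\<And>i. i \<in> I \<Longrightarrow> smooth_on S (F i)"
  shows "smooth_on S (\<lambda>x. \<Sum>i\<in>I. F i x)"
  using assms(2)
  by (induction I rule: infinite_finite_induct) (auto simp: smooth_on_const smooth_on_add[OF assms(1)])

lemma smooth_on_prod:
  fixes F :: "'i \<Rightarrow> 'a::real_normed_vector \<Rightarrow> real"
  assumes "open S" "\<And>i. i \<in> I \<Longrightarrow> smooth_on S (F i)"
  shows "smooth_on S (\<lambda>x. \<Prod>i\<in>I. F i x)"
  using assms(2)
  by (induction I rule: infinite_finite_induct)
    (auto simp: smooth_on_const smooth_on_mult[OF assms(1)])

lemma smooth_on_det: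
  fixes M :: "'a::real_normed_vector \<Rightarrow> real^'k^'k"
  assumes "open S" "\<And>i j. smooth_on S (\<lambda>x. M x $ i $ j)"
  shows "smooth_on S (\<lambda>x. det (M x))"
  unfolding det_def
  by (intro smooth_on_sum smooth_on_mult smooth_on_prod smooth_on_const assms)

lemma smooth_on_vec:
  fixes F :: "'a::real_normed_vector \<Rightarrow> real^'k"
  assumes "open S" "\<And>i. smooth_on S (\<lambda>x. F x $ i)"
  shows "smooth_on S F"
proof -
  have "F = (\<lambda>x. \<Sum>i\<in>UNIV. (F x $ i) *\<^sub>R axis i 1)"
    using basis_expansion[of "F _"] by (simp add: scalar_mult_eq_scaleR fun_eq_iff)
  moreover have "smooth_on S (\<lambda>x. \<Sum>i\<in>UNIV. (F x $ i) *\<^sub>R (axis i 1 :: real^'k))"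
    by (intro smooth_on_sum smooth_on_scaleR smooth_on_const assms)
  ultimately show ?thesis by simp
qed

text \<open>
  Two applications of the mean value theorem turn the second difference of \<open>F\<close> along \<open>u\<close> and \<open>v\<close>
  into a second derivative at an intermediate point. The difference is symmetric in \<open>u\<close> and \<open>v\<close>,
  which gives the symmetry of second derivatives below.
\<close>

lemma second_difference_mean_value:
  fixes F :: "'a::real_normed_vector \<Rightarrow> real"
  assumes F: "smooth_on S F" and "t > 0"
    and seg: "\<And>a b. 0 \<le> a \<Longrightarrow> a \<le> t \<Longrightarrow> 0 \<le> b \<Longrightarrow> b \<le> t \<Longrightarrow> x + a *\<^sub>R u + b *\<^sub>R v \<in> S"
  shows "\<exists>a b. 0 \<le> a \<and> a \<le> t \<and> 0 \<le> b \<and> b \<le> t \<and>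
    F (x + t *\<^sub>R u + t *\<^sub>R v) - F (x + t *\<^sub>R u) - F (x + t *\<^sub>R v) + F x =
      t * (t * dir_deriv (\<lambda>y. dir_deriv F y u) (x + a *\<^sub>R u + b *\<^sub>R v) v)"
proof -
  have line: "((\<lambda>s. H (y + s *\<^sub>R w)) has_real_derivative dir_deriv H (y + s *\<^sub>R w) w) (at s)"
    if "smooth_on S H" "y + s *\<^sub>R w \<in> S" for H :: "'a \<Rightarrow> real" and y w s
  proof -
    have "((\<lambda>s. y + s *\<^sub>R w) has_derivative (\<lambda>r. r *\<^sub>R w)) (at s)"
      by (auto intro!: derivative_eq_intros)
    from has_derivative_compose[OF this, of H "dir_deriv H (y + s *\<^sub>R w)"]
    have "((\<lambda>s. H (y + s *\<^sub>R w)) has_derivative (\<lambda>r. dir_deriv H (y + s *\<^sub>R w) (r *\<^sub>R w))) (at s)"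
      using smooth_on_has_derivative[OF that] by simp
    then show ?thesis
      unfolding has_field_derivative_def
      using smooth_on_linear_dir_deriv[OF that] by (simp add: linear_cmul mult.commute[of _ "dir_deriv _ _ _"])
  qed
  define p where "p s = F (x + t *\<^sub>R v + s *\<^sub>R u) - F (x + s *\<^sub>R u)" for s
  have "\<exists>a. 0 < a \<and> a < t \<and> p t - p 0 =
      (t - 0) * (dir_deriv F (x + t *\<^sub>R v + a *\<^sub>R u) u - dir_deriv F (x + a *\<^sub>R u) u)"
  proof (rule MVT2[OF \<open>t > 0\<close>])
    fix s assume "0 \<le> s" "s \<le> t"
    then have "x + t *\<^sub>R v + s *\<^sub>R u \<in> S" "x + s *\<^sub>R u \<in> S"
      using seg[of s t] seg[of s 0] \<open>t > 0\<close> by (simp_all add: add.commute add.left_commute)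
    then show "(p has_real_derivative
        dir_deriv F (x + t *\<^sub>R v + s *\<^sub>R u) u - dir_deriv F (x + s *\<^sub>R u) u) (at s)"
      unfolding p_def by (intro DERIV_diff line[OF F])
  qed
  then obtain a where a: "0 < a" "a < t"
    and pa: "p t - p 0 = t * (dir_deriv F (x + t *\<^sub>R v + a *\<^sub>R u) u - dir_deriv F (x + a *\<^sub>R u) u)"
    by auto
  define q where "q s = dir_deriv F (x + a *\<^sub>R u + s *\<^sub>R v) u" for s
  have "\<exists>b. 0 < b \<and> b < t \<and> q t - q 0 =
      (t - 0) * dir_deriv (\<lambda>y. dir_deriv F y u) (x + a *\<^sub>R u + b *\<^sub>R v) v"
  proof (rule MVT2[OF \<open>t > 0\<close>])
    fix s assume "0 \<le> s" "s \<le> t"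
    then show "(q has_real_derivative
        dir_deriv (\<lambda>y. dir_deriv F y u) (x + a *\<^sub>R u + s *\<^sub>R v) v) (at s)"
      unfolding q_def using a by (intro line[OF smooth_on_dir_deriv[OF F]] seg) auto
  qed
  then obtain b where b: "0 < b" "b < t"
    and qb: "q t - q 0 = t * dir_deriv (\<lambda>y. dir_deriv F y u) (x + a *\<^sub>R u + b *\<^sub>R v) v"
    by auto
  have "p t - p 0 = F (x + t *\<^sub>R u + t *\<^sub>R v) - F (x + t *\<^sub>R u) - F (x + t *\<^sub>R v) + F x"
    by (simp add: p_def add.commute add.left_commute)
  moreover have "q t - q 0 = dir_deriv F (x + t *\<^sub>R v + a *\<^sub>R u) u - dir_deriv F (x + a *\<^sub>R u) u"
    by (simp add: q_def add.commute add.left_commute)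
  ultimately show ?thesis
    using pa qb a b by (metis less_imp_le)
qed

lemma dir_deriv_commute_real:
  fixes F :: "'a::real_normed_vector \<Rightarrow> real"
  assumes "open S" "x \<in> S" and F: "smooth_on S F"
  shows "dir_deriv (\<lambda>y. dir_deriv F y u) x v = dir_deriv (\<lambda>y. dir_deriv F y v) x u"
proof (rule ccontr)
  define P where "P y = dir_deriv (\<lambda>y. dir_deriv F y u) y v" for y
  define Q where "Q y = dir_deriv (\<lambda>y. dir_deriv F y v) y u" for y
  assume "\<not> ?thesis"
  then have e: "\<bar>P x - Q x\<bar> > 0" by (simp add: P_def Q_def)
  have "continuous_on S P" "continuous_on S Q"
    unfolding P_def Q_def by (intro smooth_on_continuous_on smooth_on_dir_deriv F)+
  then have "continuous_on S (\<lambda>y. \<bar>P y - P x\<bar> + \<bar>Q y - Q x\<bar>)"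
    by (intro continuous_intros)
  then have "\<forall>\<^sub>F y in at x. \<bar>P y - P x\<bar> + \<bar>Q y - Q x\<bar> < \<bar>P x - Q x\<bar> / 2"
    using assms(1,2) e
    by (intro order_tendstoD[where y = "\<bar>P x - P x\<bar> + \<bar>Q x - Q x\<bar>"])
      (auto simp: continuous_on_def at_within_open[of x S] intro: order_tendstoD)
  then have "\<forall>\<^sub>F y in nhds x. y \<noteq> x \<longrightarrow> \<bar>P y - P x\<bar> + \<bar>Q y - Q x\<bar> < \<bar>P x - Q x\<bar> / 2"
    unfolding eventually_at_filter by (rule eventually_mono) simp
  with eventually_nhds_in_open[OF assms(1,2)]
  have "\<forall>\<^sub>F y in nhds x. y \<in> S \<and> \<bar>P y - P x\<bar> + \<bar>Q y - Q x\<bar> < \<bar>P x - Q x\<bar> / 2"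
    by eventually_elim (use e in auto)
  then obtain d where d: "d > 0" and
    near: "\<And>y. dist y x < d \<Longrightarrow> y \<in> S \<and> \<bar>P y - P x\<bar> + \<bar>Q y - Q x\<bar> < \<bar>P x - Q x\<bar> / 2"
    unfolding eventually_nhds_metric by blast
  \<comment> \<open>small enough that the parallelogram spanned by \<open>t u\<close> and \<open>t v\<close> at \<open>x\<close> lies in the ball of radius \<open>d\<close>\<close>
  define t where "t = d / (norm u + norm v + 1)"
  have t: "t > 0" using d by (simp add: t_def add_nonneg_pos)
  have inside: "dist (x + a *\<^sub>R u + b *\<^sub>R v) x < d" if "0 \<le> a" "a \<le> t" "0 \<le> b" "b \<le> t" for a b
  proof -
    have "dist (x + a *\<^sub>R u + b *\<^sub>R v) x \<le> a * norm u + b * norm v"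
      using norm_triangle_ineq[of "a *\<^sub>R u" "b *\<^sub>R v"] that by (simp add: dist_norm add.assoc)
    also have "\<dots> \<le> t * norm u + t * norm v"
      using that by (intro add_mono mult_right_mono) auto
    also have "\<dots> < t * (norm u + norm v + 1)"
      using t by (simp add: algebra_simps)
    also have "\<dots> = d"
      using d by (simp add: t_def add_nonneg_pos less_imp_neq[symmetric])
    finally show ?thesis .
  qed
  obtain a b where ab: "0 \<le> a" "a \<le> t" "0 \<le> b" "b \<le> t"
    and 1: "F (x + t *\<^sub>R u + t *\<^sub>R v) - F (x + t *\<^sub>R u) - F (x + t *\<^sub>R v) + F x =
      t * (t * P (x + a *\<^sub>R u + b *\<^sub>R v))"
    unfolding P_def using second_difference_mean_value[OF F t, of x u v] inside near by blast
  obtain a' b' where ab': "0 \<le> a'" "a' \<le> t" "0 \<le> b'" "b' \<le> t"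
    and 2: "F (x + t *\<^sub>R v + t *\<^sub>R u) - F (x + t *\<^sub>R v) - F (x + t *\<^sub>R u) + F x =
      t * (t * Q (x + a' *\<^sub>R v + b' *\<^sub>R u))"
  proof -
    have "x + a *\<^sub>R v + b *\<^sub>R u \<in> S" if "0 \<le> a" "a \<le> t" "0 \<le> b" "b \<le> t" for a b
      using near[of "x + b *\<^sub>R u + a *\<^sub>R v"] inside[of b a] that by (simp add: add.commute add.left_commute)
    from second_difference_mean_value[OF F t this] that show ?thesis unfolding Q_def by blast
  qed
  have "t * (t * P (x + a *\<^sub>R u + b *\<^sub>R v)) = t * (t * Q (x + b' *\<^sub>R u + a' *\<^sub>R v))"
  proof -
    have "x + c *\<^sub>R v + d *\<^sub>R u = x + d *\<^sub>R u + c *\<^sub>R v" for c d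
      by (simp add: ac_simps)
    from 1 2[unfolded this] show ?thesis by linarith
  qed
  then have "P (x + a *\<^sub>R u + b *\<^sub>R v) = Q (x + b' *\<^sub>R u + a' *\<^sub>R v)"
    using t by simp
  then show False
    using near[OF inside[OF ab]] near[OF inside[OF ab'(3,4,1,2)]] by (simp add: abs_if split: if_splits)
qed

lemma dir_deriv_commute:
  fixes F :: "'a::real_normed_vector \<Rightarrow> 'b::euclidean_space"
  assumes "open S" "x \<in> S" and F: "smooth_on S F"
  shows "dir_deriv (\<lambda>y. dir_deriv F y u) x v = dir_deriv (\<lambda>y. dir_deriv F y v) x u"
proof (rule euclidean_eqI)
  fix i :: 'b
  have c: "dir_deriv (\<lambda>y. H y \<bullet> i) z w = dir_deriv H z w \<bullet> i"
    if "smooth_on S H" "z \<in> S" for H z w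
    by (rule dir_deriv_eqI[OF has_derivative_inner_left[OF smooth_on_has_derivative[OF that]]])
  have "dir_deriv (\<lambda>y. dir_deriv F y u) x v \<bullet> i = dir_deriv (\<lambda>y. dir_deriv (\<lambda>y. F y \<bullet> i) y u) x v" for u v
    using c[OF smooth_on_dir_deriv[OF F] \<open>x \<in> S\<close>, symmetric]
      dir_deriv_cong[OF assms(1,2) c[OF F, symmetric]] by simp
  then show "dir_deriv (\<lambda>y. dir_deriv F y u) x v \<bullet> i = dir_deriv (\<lambda>y. dir_deriv F y v) x u \<bullet> i"
    using dir_deriv_commute_real[OF assms(1,2) smooth_on_bounded_linear[OF assms(1) bounded_linear_inner_left F]]
    by simp
qed

text \<open>
  Linear maps, and likewise bilinear maps, that depend smoothly on a point are described by their
  values on fixed vectors. Expanding the argument in a basis reduces \<open>y \<mapsto> L y (F y)\<close> to these.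
\<close>

lemma linear_expansion:
  fixes L :: "'a::euclidean_space \<Rightarrow> 'b::real_vector"
  assumes "linear L"
  shows "L w = (\<Sum>i\<in>Basis. (w \<bullet> i) *\<^sub>R L i)"
  by (subst euclidean_representation[of w, symmetric]) (simp add: linear_sum[OF assms] linear_cmul[OF assms])

lemma smooth_on_linear_apply:
  fixes L :: "'a::real_normed_vector \<Rightarrow> 'e::euclidean_space \<Rightarrow> 'b::real_normed_vector"
  assumes S: "open S" and L: "\<And>y. y \<in> S \<Longrightarrow> linear (L y)" "\<And>w. smooth_on S (\<lambda>y. L y w)"
    and F: "smooth_on S F"
  shows "smooth_on S (\<lambda>y. L y (F y))"
proof (subst smooth_on_cong[OF S linear_expansion[OF L(1)]])
  show "smooth_on S (\<lambda>y. \<Sum>i\<in>Basis. (F y \<bullet> i) *\<^sub>R L y i)"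
    by (intro smooth_on_sum S smooth_on_scaleR L(2) smooth_on_bounded_linear[OF S bounded_linear_inner_left F])
qed

lemma dir_deriv_linear_apply:
  fixes L :: "'a::real_normed_vector \<Rightarrow> 'e::euclidean_space \<Rightarrow> 'b::real_normed_vector"
  assumes S: "open S" "x \<in> S"
    and L: "\<And>y. y \<in> S \<Longrightarrow> linear (L y)" "\<And>w. smooth_on S (\<lambda>y. L y w)"
    and F: "smooth_on S F"
  shows "dir_deriv (\<lambda>y. L y (F y)) x u = dir_deriv (\<lambda>y. L y (F x)) x u + L x (dir_deriv F x u)"
proof -
  have *: "dir_deriv (\<lambda>y. L y (H y)) x u =
      (\<Sum>i\<in>Basis. (H x \<bullet> i) *\<^sub>R dir_deriv (\<lambda>y. L y i) x u + (dir_deriv H x u \<bullet> i) *\<^sub>R L x i)"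
    if H: "smooth_on S H" for H
  proof -
    have "dir_deriv (\<lambda>y. L y (H y)) x u = dir_deriv (\<lambda>y. \<Sum>i\<in>Basis. (H y \<bullet> i) *\<^sub>R L y i) x u"
      by (rule dir_deriv_cong[OF S linear_expansion[OF L(1)]])
    also have "\<dots> = (\<Sum>i\<in>Basis. (H x \<bullet> i) *\<^sub>R dir_deriv (\<lambda>y. L y i) x u
        + (dir_deriv H x u \<bullet> i) *\<^sub>R L x i)"
      by (intro dir_deriv_eqI has_derivative_sum has_derivative_scaleR has_derivative_inner_left
          smooth_on_has_derivative[OF H S(2)] smooth_on_has_derivative[OF L(2) S(2)])
    finally show ?thesis .
  qed
  have "dir_deriv (\<lambda>y. L y (F x)) x u = (\<Sum>i\<in>Basis. (F x \<bullet> i) *\<^sub>R dir_deriv (\<lambda>y. L y i) x u)"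
    by (subst *[OF smooth_on_const]) simp
  then show ?thesis
    by (subst *[OF F], subst linear_expansion[OF L(1)[OF S(2)], of "dir_deriv F x u"])
      (simp only: sum.distrib)
qed

lemma linear_dir_deriv_field:
  fixes L :: "'a::real_normed_vector \<Rightarrow> 'e::real_vector \<Rightarrow> 'b::real_normed_vector"
  assumes S: "open S" "x \<in> S"
    and L: "\<And>y. y \<in> S \<Longrightarrow> linear (L y)" "\<And>w. smooth_on S (\<lambda>y. L y w)"
  shows "linear (\<lambda>w. dir_deriv (\<lambda>y. L y w) x u)"
proof (rule linearI)
  note d = smooth_on_has_derivative[OF L(2) S(2)]
  show "dir_deriv (\<lambda>y. L y (w + w')) x u = dir_deriv (\<lambda>y. L y w) x u + dir_deriv (\<lambda>y. L y w') x u" for w w'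
    by (subst dir_deriv_cong[OF S linear_add[OF L(1)]], assumption)
      (rule dir_deriv_eqI[OF has_derivative_add[OF d d]])
  show "dir_deriv (\<lambda>y. L y (a *\<^sub>R w)) x u = a *\<^sub>R dir_deriv (\<lambda>y. L y w) x u" for a w
    by (subst dir_deriv_cong[OF S linear_cmul[OF L(1)]], assumption)
      (rule dir_deriv_eqI[OF has_derivative_scaleR_right[OF d]])
qed

lemma bilinear_linear:
  "bilinear B \<Longrightarrow> linear (B u)" "bilinear B \<Longrightarrow> linear (\<lambda>u. B u v)"
  by (simp_all add: bilinear_def)

lemma smooth_on_bilinear_apply:
  fixes B :: "'a::real_normed_vector \<Rightarrow> 'e::euclidean_space \<Rightarrow> 'f::euclidean_space \<Rightarrow> 'b::real_normed_vector"
  assumes S: "open S" and B: "\<And>y. y \<in> S \<Longrightarrow> bilinear (B y)" "\<And>u v. smooth_on S (\<lambda>y. B y u v)"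
    and F: "smooth_on S F" "smooth_on S H"
  shows "smooth_on S (\<lambda>y. B y (F y) (H y))"
  using bilinear_linear[OF B(1)]
  by (intro smooth_on_linear_apply[where L = "\<lambda>y u. B y u (H y)", OF S _ _ F(1)]
      smooth_on_linear_apply[OF S _ B(2) F(2)]) blast+

lemma dir_deriv_bilinear_apply:
  fixes B :: "'a::real_normed_vector \<Rightarrow> 'e::euclidean_space \<Rightarrow> 'f::euclidean_space \<Rightarrow> 'b::real_normed_vector"
  assumes S: "open S" "x \<in> S"
    and B: "\<And>y. y \<in> S \<Longrightarrow> bilinear (B y)" "\<And>u v. smooth_on S (\<lambda>y. B y u v)"
    and F: "smooth_on S F" and H: "smooth_on S H"
  shows "dir_deriv (\<lambda>y. B y (F y) (H y)) x u = dir_deriv (\<lambda>y. B y (F x) (H x)) x u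
    + B x (dir_deriv F x u) (H x) + B x (F x) (dir_deriv H x u)"
proof -
  have "dir_deriv (\<lambda>y. B y (F y) (H y)) x u =
      dir_deriv (\<lambda>y. B y (F x) (H y)) x u + B x (dir_deriv F x u) (H x)"
    using bilinear_linear[OF B(1)]
    by (intro dir_deriv_linear_apply[where L = "\<lambda>y u. B y u (H y)", OF S _ _ F]
        smooth_on_linear_apply[OF S(1) _ B(2) H]) blast+
  also have "dir_deriv (\<lambda>y. B y (F x) (H y)) x u =
      dir_deriv (\<lambda>y. B y (F x) (H x)) x u + B x (F x) (dir_deriv H x u)"
    using bilinear_linear[OF B(1)]
    by (intro dir_deriv_linear_apply[where L = "\<lambda>y. B y (F x)", OF S _ B(2) H]) blast
  finally show ?thesis by simp
qed


section \<open>Torsion-free connections in a chart\<close>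

text \<open>
  A torsion-free connection on an open set \<open>S\<close>, given by its Christoffel map: \<open>G x u v\<close> is the
  covariant derivative at \<open>x\<close> of the constant field \<open>v\<close> in the direction \<open>u\<close>.
\<close>

locale connection_chart =
  fixes S :: "'e::euclidean_space set" and G :: "'e \<Rightarrow> 'e \<Rightarrow> 'e \<Rightarrow> 'e"
  assumes open_S: "open S"
    and bilinear_G: "\<And>x. x \<in> S \<Longrightarrow> bilinear (G x)"
    and sym_G: "\<And>x u v. x \<in> S \<Longrightarrow> G x u v = G x v u"
    and smooth_G: "\<And>u v. smooth_on S (\<lambda>x. G x u v)"
begin

text \<open>
  Covariant derivative of a vector field along the constant field \<open>u\<close>. Since \<open>u\<close> is fixed,
  \<open>nabla u\<close> is an operator on fields and can be iterated.
\<close>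

definition nabla :: "'e \<Rightarrow> ('e \<Rightarrow> 'e) \<Rightarrow> 'e \<Rightarrow> 'e" where
  "nabla u F x = dir_deriv F x u + G x u (F x)"

text \<open>
  The curvature tensor \<open>R(u,v)w\<close>, with the sign for which it is the commutator of \<open>nabla u\<close> and
  \<open>nabla v\<close>.
\<close>

definition Rm :: "'e \<Rightarrow> 'e \<Rightarrow> 'e \<Rightarrow> 'e \<Rightarrow> 'e" where
  "Rm x u v w = dir_deriv (\<lambda>y. G y v w) x u - dir_deriv (\<lambda>y. G y u w) x v
     + G x u (G x v w) - G x v (G x u w)"

text \<open>Covariant derivative in the direction \<open>s\<close> of the curvature tensor, at constant arguments.\<close>

definition nabla_Rm :: "'e \<Rightarrow> 'e \<Rightarrow> 'e \<Rightarrow> 'e \<Rightarrow> 'e \<Rightarrow> 'e" where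
  "nabla_Rm x s u v w = nabla s (\<lambda>y. Rm y u v w) x
     - Rm x (G x s u) v w - Rm x u (G x s v) w - Rm x u v (G x s w)"

lemma linear_G: "x \<in> S \<Longrightarrow> linear (G x u)" "x \<in> S \<Longrightarrow> linear (\<lambda>u. G x u v)"
  using bilinear_linear[OF bilinear_G] by blast+

lemma G_simps:
  assumes "x \<in> S"
  shows "G x u (v + w) = G x u v + G x u w" "G x u (v - w) = G x u v - G x u w"
    "G x u 0 = 0" "G x u (- v) = - G x u v" "G x u (a *\<^sub>R v) = a *\<^sub>R G x u v"
    "G x (v + w) u = G x v u + G x w u" "G x (v - w) u = G x v u - G x w u"
    "G x 0 u = 0" "G x (- v) u = - G x v u" "G x (a *\<^sub>R v) u = a *\<^sub>R G x v u"
  using bilinear_G[OF assms]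
  by (simp_all add: bilinear_ladd bilinear_lsub bilinear_lzero bilinear_lneg bilinear_lmul
      bilinear_radd bilinear_rsub bilinear_rzero bilinear_rneg bilinear_rmul)

lemma smooth_G_apply: "smooth_on S F \<Longrightarrow> smooth_on S (\<lambda>y. G y v (F y))"
  by (rule smooth_on_linear_apply[where L = "\<lambda>y. G y v", OF open_S linear_G(1) smooth_G])

lemma smooth_nabla: "smooth_on S F \<Longrightarrow> smooth_on S (nabla u F)"
  unfolding nabla_def[abs_def] by (intro smooth_on_add smooth_on_dir_deriv smooth_G_apply open_S)

lemma nabla_cong:
  assumes "x \<in> S" "\<And>y. y \<in> S \<Longrightarrow> F y = H y"
  shows "nabla u F x = nabla u H x"
proof -
  have "dir_deriv F x u = dir_deriv H x u"
    using open_S assms by (rule dir_deriv_cong)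
  then show ?thesis by (simp add: nabla_def assms(2)[OF assms(1)])
qed

lemma nabla_diff:
  assumes "x \<in> S" "smooth_on S F" "smooth_on S H"
  shows "nabla u (\<lambda>y. F y - H y) x = nabla u F x - nabla u H x"
proof -
  have "dir_deriv (\<lambda>y. F y - H y) x u = dir_deriv F x u - dir_deriv H x u"
    by (intro dir_deriv_eqI has_derivative_diff smooth_on_has_derivative[where S = S] assms)
  then show ?thesis using assms(1) by (simp add: nabla_def G_simps)
qed

lemma nabla_const: "nabla u (\<lambda>_. w) x = G x u w"
  by (simp add: nabla_def)

lemma dir_deriv_G:
  assumes "x \<in> S" "smooth_on S F"
  shows "dir_deriv (\<lambda>y. G y v (F y)) x u = dir_deriv (\<lambda>y. G y v (F x)) x u + G x v (dir_deriv F x u)"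
  by (rule dir_deriv_linear_apply[where L = "\<lambda>y. G y v", OF open_S assms(1) linear_G(1) smooth_G assms(2)])

lemma nabla_nabla:
  assumes "x \<in> S" and F: "smooth_on S F"
  shows "nabla u (nabla v F) x = dir_deriv (\<lambda>y. dir_deriv F y v) x u + dir_deriv (\<lambda>y. G y v (F x)) x u
    + G x v (dir_deriv F x u) + G x u (dir_deriv F x v) + G x u (G x v (F x))"
proof -
  have "dir_deriv (nabla v F) x u =
      dir_deriv (\<lambda>y. dir_deriv F y v) x u + dir_deriv (\<lambda>y. G y v (F y)) x u"
    unfolding nabla_def[abs_def]
    by (intro dir_deriv_eqI has_derivative_add smooth_on_has_derivative[where S = S] smooth_on_dir_deriv
        smooth_G_apply F assms(1))
  then show ?thesis
    using assms(1) by (simp add: nabla_def dir_deriv_G[OF assms] G_simps)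
qed

lemma ricci_identity:
  assumes "x \<in> S" "smooth_on S F"
  shows "nabla u (nabla v F) x - nabla v (nabla u F) x = Rm x u v (F x)"
  unfolding nabla_nabla[OF assms] Rm_def
  using dir_deriv_commute[OF open_S assms, of u v] by simp

lemma Rm_eq_nabla:
  assumes "x \<in> S"
  shows "Rm x u v w = nabla u (nabla v (\<lambda>_. w)) x - nabla v (nabla u (\<lambda>_. w)) x"
  using ricci_identity[OF assms smooth_on_const] by simp

lemma smooth_Rm: "smooth_on S (\<lambda>x. Rm x u v w)"
proof (subst smooth_on_cong[OF open_S Rm_eq_nabla])
  show "smooth_on S (\<lambda>y. nabla u (nabla v (\<lambda>_. w)) y - nabla v (nabla u (\<lambda>_. w)) y)"
    by (intro smooth_on_diff open_S smooth_nabla smooth_on_const)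
qed

lemma linear_Rm:
  assumes "x \<in> S"
  shows "linear (\<lambda>u. Rm x u v w)" "linear (\<lambda>v. Rm x u v w)" "linear (\<lambda>w. Rm x u v w)"
proof -
  have d: "linear (\<lambda>u. dir_deriv (\<lambda>y. G y v w) x u)" for v w
    by (rule smooth_on_linear_dir_deriv[OF smooth_G assms])
  have d1: "linear (\<lambda>v. dir_deriv (\<lambda>y. G y v w) x u)" for u w
    by (rule linear_dir_deriv_field[where L = "\<lambda>y v. G y v w", OF open_S assms linear_G(2) smooth_G])
  have d2: "linear (\<lambda>w. dir_deriv (\<lambda>y. G y v w) x u)" for u v
    by (rule linear_dir_deriv_field[where L = "\<lambda>y. G y v", OF open_S assms linear_G(1) smooth_G])
  show "linear (\<lambda>u. Rm x u v w)"
    unfolding Rm_def by (intro linear_compose_add linear_compose_sub d d1 linear_G[OF assms]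
        linear_compose[OF linear_G(2) linear_G(1), unfolded o_def] assms)
  show "linear (\<lambda>v. Rm x u v w)"
    unfolding Rm_def by (intro linear_compose_add linear_compose_sub d d1 linear_G[OF assms]
        linear_compose[OF linear_G(2) linear_G(1), unfolded o_def] assms)
  show "linear (\<lambda>w. Rm x u v w)"
    unfolding Rm_def by (intro linear_compose_add linear_compose_sub d2
        linear_compose[OF linear_G(1) linear_G(1), unfolded o_def] assms)
qed

lemma Rm_simps:
  assumes "x \<in> S"
  shows "Rm x (u + u') v w = Rm x u v w + Rm x u' v w" "Rm x (a *\<^sub>R u) v w = a *\<^sub>R Rm x u v w"
    "Rm x u (v + v') w = Rm x u v w + Rm x u v' w" "Rm x u (a *\<^sub>R v) w = a *\<^sub>R Rm x u v w"
    "Rm x u v (w + w') = Rm x u v w + Rm x u v w'" "Rm x u v (a *\<^sub>R w) = a *\<^sub>R Rm x u v w"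
    "Rm x (u - u') v w = Rm x u v w - Rm x u' v w" "Rm x u (v - v') w = Rm x u v w - Rm x u v' w"
    "Rm x u v (w - w') = Rm x u v w - Rm x u v w'" "Rm x u v (- w) = - Rm x u v w"
    "Rm x 0 v w = 0" "Rm x u 0 w = 0" "Rm x u v 0 = 0"
  by (simp_all add: linear_add[OF linear_Rm(1)[OF assms]] linear_add[OF linear_Rm(2)[OF assms]]
      linear_add[OF linear_Rm(3)[OF assms]] linear_cmul[OF linear_Rm(1)[OF assms]]
      linear_cmul[OF linear_Rm(2)[OF assms]] linear_cmul[OF linear_Rm(3)[OF assms]]
      linear_diff[OF linear_Rm(1)[OF assms]] linear_diff[OF linear_Rm(2)[OF assms]]
      linear_diff[OF linear_Rm(3)[OF assms]] linear_neg[OF linear_Rm(3)[OF assms]]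
      linear_0[OF linear_Rm(1)[OF assms]] linear_0[OF linear_Rm(2)[OF assms]]
      linear_0[OF linear_Rm(3)[OF assms]])

lemma Rm_skew: "Rm x u v w = - Rm x v u w"
  by (simp add: Rm_def)

lemma first_bianchi:
  assumes "x \<in> S"
  shows "Rm x u v w + Rm x v w u + Rm x w u v = 0"
proof -
  have "dir_deriv (\<lambda>y. G y p q) x r = dir_deriv (\<lambda>y. G y q p) x r" for p q r
    by (rule dir_deriv_cong[OF open_S assms sym_G])
  note this[of v u w] this[of w u v] this[of w v u]
  then show ?thesis
    unfolding Rm_def using sym_G[OF assms, of v u] sym_G[OF assms, of w u] sym_G[OF assms, of w v]
    by simp
qed

lemma nabla_Rm_eq:
  assumes "x \<in> S"
  shows "nabla_Rm x s u v w =
      nabla s (nabla u (nabla v (\<lambda>_. w))) x - nabla s (nabla v (nabla u (\<lambda>_. w))) x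
      - (nabla u (nabla v (nabla s (\<lambda>_. w))) x - nabla v (nabla u (nabla s (\<lambda>_. w))) x)
      - Rm x (G x s u) v w - Rm x u (G x s v) w"
proof -
  have "nabla s (\<lambda>y. Rm y u v w) x =
      nabla s (\<lambda>y. nabla u (nabla v (\<lambda>_. w)) y - nabla v (nabla u (\<lambda>_. w)) y) x"
    by (rule nabla_cong[OF assms Rm_eq_nabla])
  also have "\<dots> = nabla s (nabla u (nabla v (\<lambda>_. w))) x - nabla s (nabla v (nabla u (\<lambda>_. w))) x"
    by (intro nabla_diff assms smooth_nabla smooth_on_const)
  finally have "nabla s (\<lambda>y. Rm y u v w) x =
      nabla s (nabla u (nabla v (\<lambda>_. w))) x - nabla s (nabla v (nabla u (\<lambda>_. w))) x" .
  moreover have "Rm x u v (G x s w) =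
      nabla u (nabla v (nabla s (\<lambda>_. w))) x - nabla v (nabla u (nabla s (\<lambda>_. w))) x"
    unfolding ricci_identity[OF assms smooth_nabla[OF smooth_on_const]] nabla_const ..
  ultimately show ?thesis by (simp add: nabla_Rm_def)
qed

text \<open>
  On constant fields the second Bianchi identity is the Jacobi identity for the operators
  \<open>nabla s\<close>, \<open>nabla u\<close>, \<open>nabla v\<close>; the remaining Christoffel terms cancel by symmetry.
\<close>

lemma second_bianchi:
  assumes "x \<in> S"
  shows "nabla_Rm x s u v w + nabla_Rm x u v s w + nabla_Rm x v s u w = 0"
  unfolding nabla_Rm_eq[OF assms]
  using Rm_skew[of x u "G x s v" w] Rm_skew[of x v "G x u s" w] Rm_skew[of x s "G x v u" w]
    sym_G[OF assms, of v s] sym_G[OF assms, of u s] sym_G[OF assms, of v u]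
  by simp

lemma nabla_Rm_skew:
  assumes "x \<in> S"
  shows "nabla_Rm x s u v w = - nabla_Rm x s v u w"
  unfolding nabla_Rm_eq[OF assms]
  using Rm_skew[of x u "G x s v" w] Rm_skew[of x v "G x s u" w] by simp

end


section \<open>The curvature of a Riemannian metric in a chart\<close>

text \<open>The representative \<open>h\<close> of a Riemannian metric on an open coordinate domain \<open>S\<close>.\<close>

locale metric_chart =
  fixes S :: "(real^'k) set" and h :: "real^'k \<Rightarrow> real^'k \<Rightarrow> real^'k \<Rightarrow> real"
  assumes open_S: "open S"
    and inner_form_h: "\<And>x. x \<in> S \<Longrightarrow> inner_form (h x)"
    and smooth_h: "\<And>u v. smooth_on S (\<lambda>x. h x u v)"
begin

lemma bilinear_h: "x \<in> S \<Longrightarrow> bilinear (h x)"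
  and sym_h: "x \<in> S \<Longrightarrow> h x u v = h x v u"
  and pos_h: "x \<in> S \<Longrightarrow> v \<noteq> 0 \<Longrightarrow> h x v v > 0"
  using inner_form_h by (auto simp: inner_form_def)

lemma h_simps:
  assumes "x \<in> S"
  shows "h x u (v + w) = h x u v + h x u w" "h x u (v - w) = h x u v - h x u w"
    "h x u 0 = 0" "h x u (- v) = - h x u v" "h x u (a *\<^sub>R v) = a * h x u v"
    "h x (v + w) u = h x v u + h x w u" "h x (v - w) u = h x v u - h x w u"
    "h x 0 u = 0" "h x (- v) u = - h x v u" "h x (a *\<^sub>R v) u = a * h x v u"
  using bilinear_h[OF assms]
  by (simp_all add: bilinear_ladd bilinear_lsub bilinear_lzero bilinear_lneg bilinear_lmul
      bilinear_radd bilinear_rsub bilinear_rzero bilinear_rneg bilinear_rmul)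

lemma h_nondegenerate: "x \<in> S \<Longrightarrow> (\<And>w. h x z w = h x z' w) \<Longrightarrow> z = z'"
  by (rule inner_form_nondegenerate[OF inner_form_h])

lemma levi_civita_christoffel:
  assumes "x \<in> S"
  shows "levi_civita_at h x (christoffel h x)"
  unfolding christoffel_def
  by (rule theI'[OF levi_civita_at_ex1[OF open_S assms inner_form_h
        smooth_on_differentiable[OF smooth_h assms]]])

lemma
  assumes "x \<in> S"
  shows bilinear_christoffel: "bilinear (christoffel h x)"
    and sym_christoffel: "christoffel h x u v = christoffel h x v u"
    and metric_compatible_const:
      "dir_deriv (\<lambda>y. h y v w) x u = h x (christoffel h x u v) w + h x v (christoffel h x u w)"
  using levi_civita_christoffel[OF assms] unfolding levi_civita_at_def by blast+

text \<open>
  By the Koszul formula \<open>christoffel h x u v\<close> solves a linear system whose matrix is the Gram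
  matrix of \<open>h x\<close>; Cramer's rule expresses the solution by determinants of smooth functions.
\<close>

lemma smooth_christoffel: "smooth_on S (\<lambda>x. christoffel h x u v)"
proof -
  define M :: "real^'k \<Rightarrow> real^'k^'k" where "M x = (\<chi> i j. h x (axis j 1) (axis i 1))" for x
  define b :: "real^'k \<Rightarrow> real^'k" where
    "b x = (\<chi> i. (dir_deriv (\<lambda>y. h y v (axis i 1)) x u + dir_deriv (\<lambda>y. h y u (axis i 1)) x v
       - dir_deriv (\<lambda>y. h y u v) x (axis i 1)) * (1/2))" for x
  have Mz: "(M x *v z) $ i = h x z (axis i 1)" if "x \<in> S" for x z i
  proof -
    have "h x z (axis i 1) = h x (\<Sum>j\<in>UNIV. (z $ j) *\<^sub>R axis j 1) (axis i 1)"
      using basis_expansion[of z] by (simp add: scalar_mult_eq_scaleR)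
    also have "\<dots> = (\<Sum>j\<in>UNIV. z $ j * h x (axis j 1) (axis i 1))"
      by (simp add: linear_sum[OF bilinear_linear(2)[OF bilinear_h[OF that]]] h_simps that)
    finally show ?thesis by (simp add: M_def matrix_vector_mult_def mult.commute)
  qed
  have det: "det (M x) \<noteq> 0" if x: "x \<in> S" for x
  proof -
    have "z = 0" if "M x *v z = 0" for z
    proof (rule ccontr)
      assume "z \<noteq> 0"
      have "h x z z = h x z (\<Sum>j\<in>UNIV. (z $ j) *\<^sub>R axis j 1)"
        using basis_expansion[of z] by (simp add: scalar_mult_eq_scaleR)
      also have "\<dots> = 0"
        using Mz[OF x, of z] \<open>M x *v z = 0\<close>
        by (simp add: linear_sum[OF bilinear_linear(1)[OF bilinear_h[OF x]]] h_simps x)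
      finally show False using pos_h[OF x \<open>z \<noteq> 0\<close>] by simp
    qed
    then show ?thesis
      using det_nz_iff_inj[of "\<lambda>z. M x *v z"] by (simp add: inj_matrix_vector_mult invertible_det_nz[symmetric]
        invertible_left_inverse matrix_left_invertible_ker)
  qed
  have eq: "M x *v christoffel h x u v = b x" if x: "x \<in> S" for x
  proof (rule vec_eq_iff[THEN iffD2], rule allI)
    fix i
    have "2 * h x (christoffel h x u v) (axis i 1) =
      dir_deriv (\<lambda>y. h y v (axis i 1)) x u + dir_deriv (\<lambda>y. h y u (axis i 1)) x v
       - dir_deriv (\<lambda>y. h y u v) x (axis i 1)"
      by (rule levi_civita_at_koszul[OF inner_form_h[OF x] levi_civita_christoffel[OF x] sym_h open_S x])
    then show "(M x *v christoffel h x u v) $ i = b x $ i"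
      by (simp add: Mz[OF x] b_def)
  qed
  have sol: "christoffel h x u v =
      (\<chi> k. det (\<chi> i j. if j = k then b x $ i else M x $ i $ j) * inverse (det (M x)))" if "x \<in> S" for x
    using cramer[THEN iffD1, OF det eq, OF that that] by (simp add: divide_inverse)
  have sM: "smooth_on S (\<lambda>x. M x $ i $ j)" for i j
    by (simp add: M_def smooth_h)
  have sb: "smooth_on S (\<lambda>x. b x $ i)" for i
    unfolding b_def by (simp only: vec_lambda_beta, intro smooth_on_mult smooth_on_add smooth_on_diff smooth_on_dir_deriv
        smooth_h smooth_on_const open_S)
  show ?thesis
  proof (rule smooth_on_vec[OF open_S])
    fix k
    have "smooth_on S (\<lambda>x. (\<chi> i j. if j = k then b x $ i else M x $ i $ j) $ i $ j)" for i j
      using sM sb by (cases "j = k") simp_all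
    then have "smooth_on S (\<lambda>x. det (\<chi> i j. if j = k then b x $ i else M x $ i $ j) * inverse (det (M x)))"
      by (intro smooth_on_mult smooth_on_inverse smooth_on_det open_S det sM)
    then show "smooth_on S (\<lambda>x. christoffel h x u v $ k)"
      by (subst smooth_on_cong[OF open_S]) (subst sol, simp_all)
  qed
qed

sublocale connection_chart S "christoffel h"
  by unfold_locales (auto simp: open_S bilinear_christoffel sym_christoffel smooth_christoffel)

lemma dir_deriv_h:
  assumes "x \<in> S" "smooth_on S F" "smooth_on S H"
  shows "dir_deriv (\<lambda>y. h y (F y) (H y)) x u = h x (nabla u F x) (H x) + h x (F x) (nabla u H x)"
proof -
  have "dir_deriv (\<lambda>y. h y (F y) (H y)) x u = dir_deriv (\<lambda>y. h y (F x) (H x)) x u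
    + h x (dir_deriv F x u) (H x) + h x (F x) (dir_deriv H x u)"
    by (rule dir_deriv_bilinear_apply[where B = h, OF open_S assms(1) bilinear_h smooth_h assms(2,3)])
  then show ?thesis
    unfolding metric_compatible_const[OF assms(1)] nabla_def by (simp add: h_simps assms(1))
qed

lemma curvature_eq_Rm:
  assumes "x \<in> S"
  shows "curvature h x u v w = Rm x u v w"
proof -
  have c: "cov_deriv h (\<lambda>_. u) (\<lambda>_. v) = (\<lambda>y. christoffel h y u v)" for u v
    by (simp add: cov_deriv_def fun_eq_iff)
  have "lie_bracket (\<lambda>_. u) (\<lambda>_. v) = (\<lambda>_. 0)"
    by (simp add: lie_bracket_def fun_eq_iff)
  then show ?thesis
    unfolding curvature_def Let_def c
    using assms by (simp add: cov_deriv_def Rm_def G_simps linear_0[OF linear_frechet_derivative])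
qed

text \<open>
  Skew-symmetry in the last two arguments: apply the commutator of two derivatives, which is zero,
  to the function \<open>h w z\<close>.
\<close>

lemma h_Rm_skew:
  assumes x: "x \<in> S"
  shows "h x (Rm x u v w) z = - h x w (Rm x u v z)"
proof -
  let ?w = "\<lambda>_. w" and ?z = "\<lambda>_. z"
  have sm: "smooth_on S (nabla p (\<lambda>_. q))" for p q
    by (intro smooth_nabla smooth_on_const)
  have second: "dir_deriv (\<lambda>y. dir_deriv (\<lambda>y. h y w z) y p) x q =
      h x (nabla q (nabla p ?w) x) z + h x (nabla p ?w x) (nabla q ?z x)
      + h x (nabla q ?w x) (nabla p ?z x) + h x w (nabla q (nabla p ?z) x)" for p q
  proof -
    have "dir_deriv (\<lambda>y. dir_deriv (\<lambda>y. h y w z) y p) x q =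
        dir_deriv (\<lambda>y. h y (nabla p ?w y) z + h y w (nabla p ?z y)) x q"
      by (rule dir_deriv_cong[OF open_S x]) (rule dir_deriv_h[OF _ smooth_on_const smooth_on_const])
    also have "\<dots> = dir_deriv (\<lambda>y. h y (nabla p ?w y) z) x q + dir_deriv (\<lambda>y. h y w (nabla p ?z y)) x q"
      by (intro dir_deriv_eqI has_derivative_add smooth_on_has_derivative[OF _ x]
          smooth_on_bilinear_apply[OF open_S bilinear_h smooth_h] sm smooth_on_const)
    finally show ?thesis
      by (simp add: dir_deriv_h[OF x sm smooth_on_const] dir_deriv_h[OF x smooth_on_const sm])
  qed
  show ?thesis
    using dir_deriv_commute[OF open_S x smooth_h, of w z v u]
    unfolding second Rm_eq_nabla[OF x] by (simp add: h_simps x)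
qed

text \<open>The pair symmetry \<open>R(u,v,w,z) = R(w,z,u,v)\<close>, from four instances of the first Bianchi identity.\<close>

lemma h_Rm_pair_sym:
  assumes x: "x \<in> S"
  shows "h x (Rm x u v w) z = h x (Rm x w z u) v"
proof -
  define R where "R a b c d = h x (Rm x a b c) d" for a b c d
  have s1: "R a b c d = - R b a c d" for a b c d
    unfolding R_def by (subst Rm_skew) (simp add: h_simps x)
  have s2: "R a b c d = - R a b d c" for a b c d
    unfolding R_def using h_Rm_skew[OF x, of a b c d] sym_h[OF x, of c "Rm x a b d"] by simp
  have b: "R a b c d + R b c a d + R c a b d = 0" for a b c d
    unfolding R_def using arg_cong[OF first_bianchi[OF x, of a b c], of "\<lambda>t. h x t d"]
    by (simp add: h_simps x)
  have "R u v w z = R w z u v"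
    using b[of u v w z] b[of v w z u] b[of w z u v] b[of z u v w]
      s1[of u v w z] s1 s2 by (smt (verit))
  then show ?thesis by (simp add: R_def)
qed

end


section \<open>Traces of linear maps\<close>

lemma trace_matrix: "trace (matrix L) = (\<Sum>i\<in>UNIV. L (axis i 1) $ i)"
  for L :: "real^'k \<Rightarrow> real^'k"
  by (simp add: trace_def matrix_def)

lemma trace_matrix_comp_commute:
  fixes L M :: "real^'k \<Rightarrow> real^'k"
  assumes "linear L" "linear M"
  shows "trace (matrix (\<lambda>u. L (M u))) = trace (matrix (\<lambda>u. M (L u)))"
  using matrix_compose[OF assms] matrix_compose[OF assms(2,1)]
    trace_mul_sym[of "matrix L" "matrix M"] by (simp add: o_def)

lemma trace_matrix_rank_one:
  fixes p :: "real^'k"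
  assumes "linear \<phi>"
  shows "trace (matrix (\<lambda>u. \<phi> u *\<^sub>R p)) = \<phi> p"
proof -
  have "\<phi> p = \<phi> (\<Sum>i\<in>UNIV. (p $ i) *\<^sub>R axis i 1)"
    using basis_expansion[of p] by (simp add: scalar_mult_eq_scaleR)
  then show ?thesis
    by (simp add: trace_matrix linear_sum[OF assms] linear_cmul[OF assms] mult.commute)
qed

lemma linear_trace_matrix:
  fixes L :: "'a::real_vector \<Rightarrow> real^'k \<Rightarrow> real^'k"
  assumes "\<And>u. linear (\<lambda>v. L v u)"
  shows "linear (\<lambda>v. trace (matrix (L v)))"
  by (rule linearI)
    (simp_all add: trace_matrix linear_add[OF assms] linear_cmul[OF assms] sum.distrib sum_distrib_left)

lemma smooth_on_trace_matrix:
  fixes L :: "'a::real_normed_vector \<Rightarrow> real^'k \<Rightarrow> real^'k"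
  assumes "open S" "\<And>u. smooth_on S (\<lambda>y. L y u)"
  shows "smooth_on S (\<lambda>y. trace (matrix (L y)))"
  unfolding trace_matrix
  by (intro smooth_on_sum assms smooth_on_bounded_linear[OF _ bounded_linear_vec_nth])

lemma dir_deriv_trace_matrix:
  fixes L :: "'a::real_normed_vector \<Rightarrow> real^'k \<Rightarrow> real^'k"
  assumes "x \<in> S" "\<And>u. smooth_on S (\<lambda>y. L y u)"
  shows "dir_deriv (\<lambda>y. trace (matrix (L y))) x s = trace (matrix (\<lambda>u. dir_deriv (\<lambda>y. L y u) x s))"
  unfolding trace_matrix
  by (intro dir_deriv_eqI has_derivative_sum bounded_linear.has_derivative[OF bounded_linear_vec_nth]
      smooth_on_has_derivative[OF assms(2,1)])


section \<open>Kaehler metrics in a chart\<close>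

context metric_chart
begin

text \<open>
  \<open>h x\<close> is not the inner product of the coordinate space, so orthogonality with respect to it is
  treated by hand.
\<close>

lemma orthogonal_spanning:
  assumes x: "x \<in> S" and "finite B" "card B = CARD('k)" "0 \<notin> B"
    and orth: "\<And>b c. b \<in> B \<Longrightarrow> c \<in> B \<Longrightarrow> b \<noteq> c \<Longrightarrow> h x b c = 0"
  shows "span B = UNIV"
proof -
  have "independent B"
    unfolding independent_explicit_finite_subsets
  proof (intro allI impI ballI)
    fix T u b assume "T \<subseteq> B" "finite T" "(\<Sum>v\<in>T. u v *\<^sub>R v) = 0" "b \<in> T"
    have "0 = h x (\<Sum>v\<in>T. u v *\<^sub>R v) b"
      using \<open>(\<Sum>v\<in>T. u v *\<^sub>R v) = 0\<close> by (simp add: h_simps x)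
    also have "\<dots> = (\<Sum>v\<in>T. u v * h x v b)"
      by (simp add: linear_sum[OF bilinear_linear(2)[OF bilinear_h[OF x]]] h_simps x)
    also have "\<dots> = (\<Sum>v\<in>T. if v = b then u b * h x b b else 0)"
      using orth \<open>T \<subseteq> B\<close> \<open>b \<in> T\<close> by (intro sum.cong) auto
    also have "\<dots> = u b * h x b b"
      using \<open>finite T\<close> \<open>b \<in> T\<close> by simp
    finally have "u b * h x b b = 0" by simp
    moreover have "b \<noteq> 0" using \<open>0 \<notin> B\<close> \<open>T \<subseteq> B\<close> \<open>b \<in> T\<close> by blast
    ultimately show "u b = 0" using pos_h[OF x, of b] by simp
  qed
  then show ?thesis
    using card_ge_dim_independent[of B UNIV] assms(3) by auto
qed

end

text \<open>The representatives of a Kaehler metric and its complex structure in a chart.\<close>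

locale kaehler_chart = metric_chart S h
  for S :: "(real^'k) set" and h :: "real^'k \<Rightarrow> real^'k \<Rightarrow> real^'k \<Rightarrow> real" +
  fixes J :: "real^'k \<Rightarrow> real^'k \<Rightarrow> real^'k"
  assumes linear_J: "\<And>x. x \<in> S \<Longrightarrow> linear (J x)"
    and smooth_J: "\<And>v. smooth_on S (\<lambda>x. J x v)"
    and J_J: "\<And>x v. x \<in> S \<Longrightarrow> J x (J x v) = - v"
    and h_J_J: "\<And>x u v. x \<in> S \<Longrightarrow> h x (J x u) (J x v) = h x u v"
    and parallel_J: "\<And>x u v. x \<in> S \<Longrightarrow> cov_deriv_endo h J x u v = 0"
begin

lemma J_simps:
  assumes "x \<in> S"
  shows "J x (u + v) = J x u + J x v" "J x (u - v) = J x u - J x v" "J x (- u) = - J x u"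
    "J x 0 = 0" "J x (a *\<^sub>R u) = a *\<^sub>R J x u"
  using linear_J[OF assms] by (simp_all add: linear_add linear_diff linear_0 linear_neg linear_cmul)

lemma h_J_left: "x \<in> S \<Longrightarrow> h x (J x u) v = - h x u (J x v)"
  using h_J_J[of x u "J x v"] by (simp add: J_J h_simps)

lemma h_J_self [simp]: "x \<in> S \<Longrightarrow> h x u (J x u) = 0"
  using h_J_left[of x u u] sym_h[of x "J x u" u] by simp

lemma dir_deriv_J:
  "x \<in> S \<Longrightarrow> dir_deriv (\<lambda>y. J y v) x u = J x (christoffel h x u v) - christoffel h x u (J x v)"
  using parallel_J[of x u v] by (simp add: cov_deriv_endo_def cov_deriv_def algebra_simps)

lemma nabla_J:
  assumes "x \<in> S" "smooth_on S F"
  shows "nabla u (\<lambda>y. J y (F y)) x = J x (nabla u F x)"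
proof -
  have "dir_deriv (\<lambda>y. J y (F y)) x u = dir_deriv (\<lambda>y. J y (F x)) x u + J x (dir_deriv F x u)"
    by (rule dir_deriv_linear_apply[where L = J, OF open_S assms(1) linear_J smooth_J assms(2)])
  then show ?thesis
    by (simp add: nabla_def dir_deriv_J J_simps assms(1))
qed

lemma Rm_J:
  assumes x: "x \<in> S"
  shows "Rm x u v (J x w) = J x (Rm x u v w)"
proof -
  have "nabla u (nabla v (\<lambda>y. J y w)) x = J x (nabla u (nabla v (\<lambda>_. w)) x)" for u v
  proof -
    have "nabla u (nabla v (\<lambda>y. J y w)) x = nabla u (\<lambda>y. J y (nabla v (\<lambda>_. w) y)) x"
      by (rule nabla_cong[OF x]) (rule nabla_J[OF _ smooth_on_const])
    also have "\<dots> = J x (nabla u (nabla v (\<lambda>_. w)) x)"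
      by (rule nabla_J[OF x smooth_nabla[OF smooth_on_const]])
    finally show ?thesis .
  qed
  then show ?thesis
    using ricci_identity[OF x smooth_J, of u v w] by (simp add: Rm_eq_nabla x J_simps)
qed

text \<open>By pair symmetry the commutation with \<open>J\<close> passes to the first two arguments.\<close>

lemma Rm_J_J:
  assumes x: "x \<in> S"
  shows "Rm x (J x u) (J x v) w = Rm x u v w"
proof (rule h_nondegenerate[OF x])
  fix z
  show "h x (Rm x (J x u) (J x v) w) z = h x (Rm x u v w) z"
    by (simp only: h_Rm_pair_sym[OF x, of _ _ w z] Rm_J[OF x] h_J_J[OF x])
qed

lemma orthogonal_vector_exists:
  assumes x: "x \<in> S" and card: "CARD('k) > 2"
  shows "\<exists>z. z \<noteq> 0 \<and> h x y z = 0 \<and> h x (J x y) z = 0"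
proof -
  have "dim (UNIV :: (real^'k) set) \<le> card {y, J x y}" if "span {y, J x y} = UNIV"
    using that by (intro dim_le_card) auto
  moreover have "card {y, J x y} \<le> 2"
    by (simp add: card_insert_if)
  ultimately obtain u where u: "u \<notin> span {y, J x y}"
    using card by fastforce
  show ?thesis
  proof (cases "y = 0")
    case True
    then show ?thesis using u by (intro exI[of _ u]) (auto simp: h_simps J_simps x)
  next
    case False
    then have p: "h x y y \<noteq> 0" using pos_h[OF x, of y] by simp
    \<comment> \<open>Gram--Schmidt, where \<open>y\<close> and \<open>J y\<close> are orthogonal and of equal length\<close>
    define z where "z = u - (h x y u / h x y y) *\<^sub>R y - (h x (J x y) u / h x y y) *\<^sub>R J x y"
    have "z \<noteq> 0"
    proof
      assume "z = 0"
      then have "u = (h x y u / h x y y) *\<^sub>R y + (h x (J x y) u / h x y y) *\<^sub>R J x y"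
        by (simp add: z_def algebra_simps)
      also have "\<dots> \<in> span {y, J x y}"
        by (intro span_add span_scale span_base) auto
      finally show False using u by blast
    qed
    moreover have "h x y z = 0" "h x (J x y) z = 0"
      using p h_J_left[OF x, of y y] by (simp_all add: z_def h_simps x h_J_J)
    ultimately show ?thesis by blast
  qed
qed

end


section \<open>Closed conformal fields on Kaehler manifolds\<close>

text \<open>
  A closed conformal field \<open>X\<close> with conformal factor \<open>\<psi>\<close>, which is here a function of the
  coordinates.
\<close>

locale conformal_chart = kaehler_chart S h J
  for S :: "(real^'k) set" and h J +
  fixes X :: "real^'k \<Rightarrow> real^'k" and \<psi> :: "real^'k \<Rightarrow> real"
  assumes smooth_X: "smooth_on S X" and smooth_factor: "smooth_on S \<psi>"
    and nabla_X: "\<And>x v. x \<in> S \<Longrightarrow> nabla v X x = \<psi> x *\<^sub>R v"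
    and card_gt_2: "CARD('k) > 2"
begin

lemma Rm_X:
  assumes x: "x \<in> S"
  shows "Rm x u v (X x) = dir_deriv \<psi> x u *\<^sub>R v - dir_deriv \<psi> x v *\<^sub>R u"
proof -
  have "nabla u (nabla v X) x = dir_deriv \<psi> x u *\<^sub>R v + \<psi> x *\<^sub>R christoffel h x u v" for u v
  proof -
    have "nabla u (nabla v X) x = nabla u (\<lambda>y. \<psi> y *\<^sub>R v) x"
      by (rule nabla_cong[OF x nabla_X])
    moreover have "dir_deriv (\<lambda>y. \<psi> y *\<^sub>R v) x u = dir_deriv \<psi> x u *\<^sub>R v"
      by (rule dir_deriv_eqI)
        (rule has_derivative_scaleR_left[OF smooth_on_has_derivative[OF smooth_factor x]])
    ultimately show ?thesis by (simp add: nabla_def G_simps x)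
  qed
  then show ?thesis
    using ricci_identity[OF x smooth_X, of u v] sym_G[OF x, of u v] by simp
qed

text \<open>
  Invariance of the curvature under \<open>J\<close> gives
  \<open>d\<psi>(u) z - d\<psi>(z) u = d\<psi>(J u) J z - d\<psi>(J z) J u\<close>; for \<open>z\<close> orthogonal to \<open>u\<close> and \<open>J u\<close> the
  inner product with \<open>z\<close> leaves only the first term.
\<close>

lemma dir_deriv_factor_zero:
  assumes x: "x \<in> S"
  shows "dir_deriv \<psi> x u = 0"
proof -
  obtain z where z: "z \<noteq> 0" "h x u z = 0" "h x (J x u) z = 0"
    using orthogonal_vector_exists[OF x card_gt_2] by blast
  have "h x (Rm x (J x u) (J x z) (X x)) z = h x (Rm x u z (X x)) z"
    by (simp only: Rm_J_J[OF x])
  then have "dir_deriv \<psi> x u * h x z z = 0"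
    using z h_J_left[OF x, of z z] by (simp add: Rm_X x h_simps)
  then show ?thesis
    using pos_h[OF x z(1)] by simp
qed

end

text \<open>The case of a nonzero constant conformal factor \<open>a\<close>; the dimension plays no role here.\<close>

locale homothetic_chart = kaehler_chart S h J
  for S :: "(real^'k) set" and h J +
  fixes X :: "real^'k \<Rightarrow> real^'k" and a :: real
  assumes smooth_X: "smooth_on S X"
    and nabla_X: "\<And>x v. x \<in> S \<Longrightarrow> nabla v X x = a *\<^sub>R v"
    and a_nonzero: "a \<noteq> 0"
begin

lemma dir_deriv_X: "x \<in> S \<Longrightarrow> dir_deriv X x v = a *\<^sub>R v - christoffel h x v (X x)"
  using nabla_X[of x v] by (simp add: nabla_def algebra_simps)

lemma lie_deriv_J:
  assumes x: "x \<in> S"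
  shows "lie_deriv_endo X J x v = 0"
  using sym_G[OF x, of "J x v" "X x"] sym_G[OF x, of v "X x"]
  by (simp add: lie_deriv_endo_def lie_bracket_def dir_deriv_J dir_deriv_X x J_simps)

lemma Rm_X_right:
  assumes x: "x \<in> S"
  shows "Rm x u v (X x) = 0"
proof -
  have "nabla u (nabla v X) x = a *\<^sub>R christoffel h x u v" for u v
  proof -
    have "nabla u (nabla v X) x = nabla u (\<lambda>_. a *\<^sub>R v) x"
      by (rule nabla_cong[OF x nabla_X])
    then show ?thesis by (simp add: nabla_const G_simps x)
  qed
  then show ?thesis
    using ricci_identity[OF x smooth_X, of u v] sym_G[OF x, of u v] by simp
qed

lemma Rm_X_left:
  assumes x: "x \<in> S"
  shows "Rm x (X x) v w = 0"
proof (rule h_nondegenerate[OF x])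
  show "h x (Rm x (X x) v w) z = h x 0 z" for z
    using h_Rm_pair_sym[OF x, of "X x" v w z] Rm_X_right[OF x] by (simp add: h_simps x)
qed

lemma Rm_X_middle: "x \<in> S \<Longrightarrow> Rm x u (X x) w = 0"
  using Rm_skew[of x u "X x" w] Rm_X_left by simp

text \<open>Differentiate \<open>R(v,X)w = 0\<close> in the direction \<open>s\<close>.\<close>

lemma nabla_Rm_X_middle:
  assumes x: "x \<in> S"
  shows "nabla_Rm x s v (X x) w = - (a *\<^sub>R Rm x v s w)"
proof -
  have "dir_deriv (\<lambda>y. Rm y v (X y) w) x s =
      dir_deriv (\<lambda>y. Rm y v (X x) w) x s + Rm x v (dir_deriv X x s) w"
    by (rule dir_deriv_linear_apply[where L = "\<lambda>y z. Rm y v z w", OF open_S x linear_Rm(2) smooth_Rm smooth_X])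
  moreover have "dir_deriv (\<lambda>y. Rm y v (X y) w) x s = dir_deriv (\<lambda>y. 0) x s"
    by (rule dir_deriv_cong[OF open_S x Rm_X_middle])
  ultimately have "dir_deriv (\<lambda>y. Rm y v (X x) w) x s = - Rm x v (a *\<^sub>R s - christoffel h x s (X x)) w"
    by (simp add: dir_deriv_X x eq_neg_iff_add_eq_0)
  then show ?thesis
    by (simp add: nabla_Rm_def nabla_def Rm_X_middle G_simps x Rm_simps)
qed

text \<open>
  The second Bianchi identity with one argument equal to \<open>X\<close>. Equivalently, \<open>L\<^sub>X R = 0\<close>.
\<close>

lemma nabla_X_Rm:
  assumes x: "x \<in> S"
  shows "nabla_Rm x (X x) u v w = - ((2 * a) *\<^sub>R Rm x u v w)"
proof -
  have "nabla_Rm x u v (X x) w = a *\<^sub>R Rm x u v w"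
    unfolding nabla_Rm_X_middle[OF x] by (subst Rm_skew) simp
  moreover have "nabla_Rm x v (X x) u w = a *\<^sub>R Rm x u v w"
    using nabla_Rm_skew[OF x, of v "X x" u w] nabla_Rm_X_middle[OF x, of v u w] by simp
  moreover have "(2 * a) *\<^sub>R Rm x u v w = a *\<^sub>R Rm x u v w + a *\<^sub>R Rm x u v w"
    by (simp add: scaleR_left_distrib[symmetric])
  ultimately show ?thesis
    using second_bianchi[OF x, of "X x" u v w] by (simp add: add_eq_0_iff)
qed

end


section \<open>Ricci curvature\<close>

context metric_chart
begin

definition Ric :: "real^'k \<Rightarrow> real^'k \<Rightarrow> real^'k \<Rightarrow> real" where
  "Ric x v w = trace (matrix (\<lambda>u. Rm x u v w))"

lemma ricci_eq_Ric: "x \<in> S \<Longrightarrow> ricci h x v w = Ric x v w"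
  by (simp add: ricci_def Ric_def curvature_eq_Rm)

lemma linear_Ric: "x \<in> S \<Longrightarrow> linear (\<lambda>v. Ric x v w)"
  unfolding Ric_def by (rule linear_trace_matrix, erule linear_Rm)

lemma Ric_simps:
  assumes "x \<in> S"
  shows "Ric x (u - v) w = Ric x u w - Ric x v w" "Ric x (c *\<^sub>R v) w = c * Ric x v w"
  by (simp_all add: linear_diff[OF linear_Ric[OF assms]] linear_cmul[OF linear_Ric[OF assms]])

lemma smooth_Ric: "smooth_on S (\<lambda>x. Ric x v w)"
  unfolding Ric_def by (intro smooth_on_trace_matrix open_S smooth_Rm)

text \<open>Covariant derivative in the direction \<open>s\<close> of a field \<open>T\<close> of bilinear forms, at constant arguments.\<close>

definition nabla_form ::
  "(real^'k \<Rightarrow> real^'k \<Rightarrow> real^'k \<Rightarrow> real) \<Rightarrow> real^'k \<Rightarrow> real^'k \<Rightarrow> real^'k \<Rightarrow> real^'k \<Rightarrow> real" where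
  "nabla_form T x s v w = dir_deriv (\<lambda>y. T y v w) x s
     - T x (christoffel h x s v) w - T x v (christoffel h x s w)"

text \<open>The covariant derivative commutes with the trace.\<close>

lemma nabla_Ric:
  assumes x: "x \<in> S"
  shows "nabla_form Ric x s v w = trace (matrix (\<lambda>u. nabla_Rm x s u v w))"
proof -
  let ?G = "christoffel h x s"
  have "nabla_Rm x s u v w = dir_deriv (\<lambda>y. Rm y u v w) x s + ?G (Rm x u v w)
      - Rm x (?G u) v w - Rm x u (?G v) w - Rm x u v (?G w)" for u
    by (simp add: nabla_Rm_def nabla_def)
  then have "trace (matrix (\<lambda>u. nabla_Rm x s u v w)) =
      trace (matrix (\<lambda>u. dir_deriv (\<lambda>y. Rm y u v w) x s)) + trace (matrix (\<lambda>u. ?G (Rm x u v w)))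
      - trace (matrix (\<lambda>u. Rm x (?G u) v w)) - Ric x (?G v) w - Ric x v (?G w)"
    by (simp add: trace_matrix Ric_def sum.distrib sum_subtractf)
  also have "trace (matrix (\<lambda>u. ?G (Rm x u v w))) = trace (matrix (\<lambda>u. Rm x (?G u) v w))"
    by (rule trace_matrix_comp_commute[OF linear_G(1)[OF x] linear_Rm(1)[OF x]])
  also have "trace (matrix (\<lambda>u. dir_deriv (\<lambda>y. Rm y u v w) x s)) = dir_deriv (\<lambda>y. Ric y v w) x s"
    unfolding Ric_def by (rule dir_deriv_trace_matrix[OF x smooth_Rm, symmetric])
  finally show ?thesis by (simp add: nabla_form_def)
qed

text \<open>The Ricci identity for the 1-form \<open>df\<close>.\<close>

lemma nabla_hessian_skew:
  assumes x: "x \<in> S" and f: "smooth_on S f"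
  shows "nabla_form (hessian h f) x u v w - nabla_form (hessian h f) x v u w = - dir_deriv f x (Rm x u v w)"
proof -
  have H: "hessian h f y v w = dir_deriv (\<lambda>z. dir_deriv f z w) y v - dir_deriv f y (christoffel h y v w)"
    for y v w
    by (simp add: hessian_def cov_deriv_def)
  have D: "dir_deriv (\<lambda>y. hessian h f y v w) x u =
      dir_deriv (\<lambda>y. dir_deriv (\<lambda>z. dir_deriv f z w) y v) x u
      - (dir_deriv (\<lambda>y. dir_deriv f y (christoffel h x v w)) x u
        + dir_deriv f x (dir_deriv (\<lambda>y. christoffel h y v w) x u))" for u v
  proof -
    have "smooth_on S (\<lambda>y. dir_deriv f y (christoffel h y v w))"
      by (rule smooth_on_linear_apply[where L = "\<lambda>y. dir_deriv f y",
          OF open_S smooth_on_linear_dir_deriv[OF f] smooth_on_dir_deriv[OF f] smooth_G])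
    then have "dir_deriv (\<lambda>y. hessian h f y v w) x u =
        dir_deriv (\<lambda>y. dir_deriv (\<lambda>z. dir_deriv f z w) y v) x u
        - dir_deriv (\<lambda>y. dir_deriv f y (christoffel h y v w)) x u"
      unfolding H
      by (intro dir_deriv_eqI has_derivative_diff smooth_on_has_derivative[where S = S]
          smooth_on_dir_deriv f x)
    also have "dir_deriv (\<lambda>y. dir_deriv f y (christoffel h y v w)) x u =
        dir_deriv (\<lambda>y. dir_deriv f y (christoffel h x v w)) x u
        + dir_deriv f x (dir_deriv (\<lambda>y. christoffel h y v w) x u)"
      by (rule dir_deriv_linear_apply[where L = "\<lambda>y. dir_deriv f y",
          OF open_S x smooth_on_linear_dir_deriv[OF f] smooth_on_dir_deriv[OF f] smooth_G])
    finally show ?thesis .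
  qed
  have lin: "dir_deriv f x (p + q) = dir_deriv f x p + dir_deriv f x q"
    "dir_deriv f x (p - q) = dir_deriv f x p - dir_deriv f x q" for p q
    using smooth_on_linear_dir_deriv[OF f x] by (simp_all add: linear_add linear_diff)
  show ?thesis
    unfolding nabla_form_def D
    unfolding H Rm_def lin
    using dir_deriv_commute[OF open_S x smooth_on_dir_deriv[OF f], of w u v] sym_G[OF x, of u v]
    by simp
qed

end

context homothetic_chart
begin

lemma Ric_X:
  assumes "x \<in> S"
  shows "Ric x (X x) w = 0"
  by (simp add: Ric_def Rm_X_middle assms trace_matrix)

lemma nabla_X_Ric:
  assumes x: "x \<in> S"
  shows "nabla_form Ric x (X x) v w = - (2 * a) * Ric x v w"
  unfolding nabla_Ric[OF x] nabla_X_Rm[OF x] Ric_def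
  by (simp add: trace_matrix sum_negf sum_distrib_left)

text \<open>Differentiate \<open>Ric(X,w) = 0\<close> in the direction \<open>v\<close>.\<close>

lemma nabla_Ric_X:
  assumes x: "x \<in> S"
  shows "nabla_form Ric x v (X x) w = - (a * Ric x v w)"
proof -
  have "dir_deriv (\<lambda>y. Ric y (X y) w) x v =
      dir_deriv (\<lambda>y. Ric y (X x) w) x v + Ric x (dir_deriv X x v) w"
    by (rule dir_deriv_linear_apply[where L = "\<lambda>y z. Ric y z w", OF open_S x linear_Ric smooth_Ric smooth_X])
  moreover have "dir_deriv (\<lambda>y. Ric y (X y) w) x v = dir_deriv (\<lambda>y. 0) x v"
    by (rule dir_deriv_cong[OF open_S x Ric_X])
  ultimately show ?thesis
    by (simp add: nabla_form_def dir_deriv_X x Ric_X Ric_simps)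
qed

text \<open>
  The soliton equation makes \<open>\<nabla>Ric\<close> symmetric up to curvature terms, which vanish in the
  direction \<open>X\<close>. So the covariant derivative of \<open>Ric\<close> along \<open>X\<close> is also \<open>-a Ric\<close>, and
  comparison with the scaling behaviour \<open>-2 a Ric\<close> leaves \<open>Ric = 0\<close>.
\<close>

lemma soliton_Ric_zero:
  assumes f: "smooth_on S f"
    and soliton: "\<And>x u v. x \<in> S \<Longrightarrow> Ric x u v + hessian h f x u v = lam * h x u v"
    and x: "x \<in> S"
  shows "Ric x v w = 0"
proof -
  have smooth_hess: "smooth_on S (\<lambda>y. hessian h f y v w)" for v w
    by (subst smooth_on_cong[OF open_S, of _ "\<lambda>y. lam * h y v w - Ric y v w"])
      (auto simp: soliton[symmetric] intro!: smooth_on_diff open_S smooth_Ric smooth_on_mult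
        smooth_on_const smooth_h)
  have "nabla_form Ric x s v w = - nabla_form (hessian h f) x s v w" for s v w
  proof -
    have "dir_deriv (\<lambda>y. Ric y v w) x s = dir_deriv (\<lambda>y. lam * h y v w - hessian h f y v w) x s"
      by (rule dir_deriv_cong[OF open_S x]) (simp add: soliton[symmetric])
    also have "\<dots> = lam * dir_deriv (\<lambda>y. h y v w) x s - dir_deriv (\<lambda>y. hessian h f y v w) x s"
      by (intro dir_deriv_eqI has_derivative_diff has_derivative_mult_right
          smooth_on_has_derivative[where S = S] smooth_h smooth_hess x)
    finally have "dir_deriv (\<lambda>y. Ric y v w) x s =
        lam * (h x (christoffel h x s v) w + h x v (christoffel h x s w))
        - dir_deriv (\<lambda>y. hessian h f y v w) x s"
      by (simp add: metric_compatible_const x)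
    then show ?thesis
      using soliton[OF x, of "christoffel h x s v" w] soliton[OF x, of v "christoffel h x s w"]
      by (simp add: nabla_form_def algebra_simps)
  qed
  then have "nabla_form Ric x (X x) v w = nabla_form Ric x v (X x) w"
    using nabla_hessian_skew[OF x f, of "X x" v w] linear_0[OF smooth_on_linear_dir_deriv[OF f x]]
    by (simp add: Rm_X_left x)
  then show ?thesis
    using nabla_X_Ric[OF x] nabla_Ric_X[OF x] a_nonzero by simp
qed


section \<open>Flatness in real dimension four\<close>

text \<open>
  Away from the zeros of \<open>X\<close> the only curvature component left is the one in the \<open>J\<close>-invariant
  plane orthogonal to \<open>X\<close> and \<open>J X\<close>, and this is also a Ricci curvature.
\<close>

lemma Rm_zero_of_X_nonzero:
  assumes x: "x \<in> S" and card: "CARD('k) = 4" and "X x \<noteq> 0" and ric: "\<And>v w. Ric x v w = 0"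
  shows "Rm x u v w = 0"
proof -
  obtain Y where Y: "Y \<noteq> 0" "h x (X x) Y = 0" "h x (J x (X x)) Y = 0"
    using orthogonal_vector_exists[OF x, of "X x"] card by auto
  define e1 e2 e4 where "e1 = X x" and "e2 = J x (X x)" and "e4 = J x Y"
  have J_nz: "J x z \<noteq> 0" if "z \<noteq> 0" for z
    using that J_J[OF x, of z] by (auto simp: J_simps x)
  have nz: "e1 \<noteq> 0" "e2 \<noteq> 0" "Y \<noteq> 0" "e4 \<noteq> 0"
    using assms Y J_nz by (auto simp: e1_def e2_def e4_def)
  have orth: "h x e1 e2 = 0" "h x e1 Y = 0" "h x e1 e4 = 0" "h x e2 Y = 0" "h x e2 e4 = 0" "h x Y e4 = 0"
    using Y h_J_left[OF x, of "X x" Y] h_J_J[OF x, of "X x" Y] x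
    by (simp_all add: e1_def e2_def e4_def)
  have orth': "h x e2 e1 = 0" "h x Y e1 = 0" "h x e4 e1 = 0" "h x Y e2 = 0" "h x e4 e2 = 0" "h x e4 Y = 0"
    using orth sym_h[OF x] by metis+
  have self: "h x e1 e1 > 0" "h x e2 e2 > 0" "h x Y Y > 0" "h x e4 e4 > 0"
    using nz pos_h[OF x] by blast+
  have "card {e1, e2, Y, e4} = 4"
  proof -
    have "e1 \<noteq> e2" "e1 \<noteq> Y" "e1 \<noteq> e4" "e2 \<noteq> Y" "e2 \<noteq> e4" "Y \<noteq> e4"
      using orth self by auto
    then show ?thesis by simp
  qed
  then have "span {e1, e2, Y, e4} = UNIV"
    using nz orth orth' card by (intro orthogonal_spanning[OF x]) auto
  then have ex: "\<exists>\<alpha> \<beta> \<gamma> \<delta>. z = \<alpha> *\<^sub>R e1 + \<beta> *\<^sub>R e2 + \<gamma> *\<^sub>R Y + \<delta> *\<^sub>R e4" for z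
  proof -
    have "z \<in> span {e1, e2, Y, e4}" using \<open>span {e1, e2, Y, e4} = UNIV\<close> by simp
    then obtain \<alpha> \<beta> \<gamma> \<delta> where "z - \<alpha> *\<^sub>R e1 - \<beta> *\<^sub>R e2 - \<gamma> *\<^sub>R Y - \<delta> *\<^sub>R e4 = 0"
      by (auto simp: span_breakdown_eq)
    then have "z = \<alpha> *\<^sub>R e1 + \<beta> *\<^sub>R e2 + \<gamma> *\<^sub>R Y + \<delta> *\<^sub>R e4"
      by (simp add: algebra_simps)
    then show ?thesis by blast
  qed
  have right: "Rm x p q e1 = 0" "Rm x p q e2 = 0" for p q
    using Rm_X_right[OF x] by (simp_all add: e1_def e2_def Rm_J x J_simps)
  have left: "Rm x e1 p q = 0" "Rm x e2 p q = 0" for p q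
    using Rm_X_left[OF x] Rm_J_J[OF x, of "X x" "J x p" q]
    by (simp_all add: e1_def e2_def J_J x linear_neg[OF linear_Rm(2)[OF x]])
  have middle: "Rm x p e1 q = 0" "Rm x p e2 q = 0" for p q
    using left Rm_skew[of x p e1 q] Rm_skew[of x p e2 q] by simp_all
  have same: "Rm x p p q = 0" for p q
    by (simp add: Rm_def)
  \<comment> \<open>\<open>z \<mapsto> R(z, J Y) J Y\<close> has rank at most one, and its trace is \<open>Ric(J Y, J Y) = 0\<close>\<close>
  define p where "p = Rm x Y e4 e4"
  have "Rm x z e4 e4 = (h x z Y / h x Y Y) *\<^sub>R p" for z
  proof -
    obtain \<alpha> \<beta> \<gamma> \<delta> where z: "z = \<alpha> *\<^sub>R e1 + \<beta> *\<^sub>R e2 + \<gamma> *\<^sub>R Y + \<delta> *\<^sub>R e4"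
      using ex by blast
    have "h x z Y = \<gamma> * h x Y Y"
      by (simp add: z h_simps x orth orth')
    moreover have "Rm x z e4 e4 = \<gamma> *\<^sub>R p"
      by (simp add: z Rm_simps x left same p_def)
    ultimately show ?thesis using self by simp
  qed
  moreover have "linear (\<lambda>z. h x z Y / h x Y Y)"
    by (rule linearI) (simp_all add: h_simps x add_divide_distrib)
  ultimately have "Ric x e4 e4 = h x p Y / h x Y Y"
    by (simp add: Ric_def trace_matrix_rank_one)
  then have "h x p Y = 0"
    using ric self by simp
  moreover have "h x p e4 = 0"
    using h_Rm_skew[OF x, of Y e4 e4 e4] sym_h[OF x, of p e4] by (simp add: p_def)
  moreover have "h x p e1 = 0" "h x p e2 = 0"
    by (simp_all add: p_def h_Rm_skew[OF x, of Y e4 e4] right h_simps x)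
  moreover obtain \<alpha> \<beta> \<gamma> \<delta> where p: "p = \<alpha> *\<^sub>R e1 + \<beta> *\<^sub>R e2 + \<gamma> *\<^sub>R Y + \<delta> *\<^sub>R e4"
    using ex by blast
  ultimately have "h x p p = 0"
    by (subst (2) p) (simp add: h_simps x)
  then have "p = 0"
    using pos_h[OF x, of p] by force
  then have Y4: "Rm x Y e4 e4 = 0" by (simp add: p_def)
  have Y3: "Rm x Y e4 Y = 0"
    using Y4 Rm_J[OF x, of Y e4 Y] J_nz by (auto simp: e4_def)
  have plane: "Rm x Y e4 q = 0" for q
  proof -
    obtain \<alpha> \<beta> \<gamma> \<delta> where q: "q = \<alpha> *\<^sub>R e1 + \<beta> *\<^sub>R e2 + \<gamma> *\<^sub>R Y + \<delta> *\<^sub>R e4"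
      using ex by blast
    show ?thesis by (simp add: q Rm_simps x right Y3 Y4)
  qed
  then have plane': "Rm x e4 Y q = 0" for q
    using Rm_skew[of x e4 Y q] by simp
  obtain \<alpha> \<beta> \<gamma> \<delta> where u: "u = \<alpha> *\<^sub>R e1 + \<beta> *\<^sub>R e2 + \<gamma> *\<^sub>R Y + \<delta> *\<^sub>R e4"
    using ex by blast
  obtain \<alpha>' \<beta>' \<gamma>' \<delta>' where v: "v = \<alpha>' *\<^sub>R e1 + \<beta>' *\<^sub>R e2 + \<gamma>' *\<^sub>R Y + \<delta>' *\<^sub>R e4"
    using ex by blast
  show ?thesis
    by (simp add: u v Rm_simps x left middle plane plane' same)
qed

text \<open>Since \<open>\<nabla>X = a I\<close> with \<open>a \<noteq> 0\<close>, the field \<open>X\<close> vanishes on no nonempty open set.\<close>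

lemma Rm_zero:
  assumes x: "x \<in> S" and card: "CARD('k) = 4" and ric: "\<And>x v w. x \<in> S \<Longrightarrow> Ric x v w = 0"
  shows "Rm x u v w = 0"
proof (rule ccontr)
  assume nz: "Rm x u v w \<noteq> 0"
  define N where "N = {y \<in> S. Rm y u v w \<noteq> 0}"
  have "open N"
    unfolding N_def
    using continuous_open_preimage[OF smooth_on_continuous_on[OF smooth_Rm, of u v w] open_S, of "- {0}"]
    by (simp add: vimage_def Int_def open_Compl)
  have "X y = 0" if "y \<in> N" for y
    using that Rm_zero_of_X_nonzero[OF _ card] ric by (auto simp: N_def)
  moreover have "x \<in> N" using x nz by (simp add: N_def)
  ultimately have "dir_deriv X x z = dir_deriv (\<lambda>_. 0) x z" for z :: "real^'k"
    using dir_deriv_cong[of N x X "\<lambda>_. 0"] \<open>open N\<close> by blast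
  then have "a *\<^sub>R z = 0" for z :: "real^'k"
    using nabla_X[OF x, of z] \<open>\<And>y. y \<in> N \<Longrightarrow> X y = 0\<close> \<open>x \<in> N\<close> by (simp add: nabla_def G_simps x)
  then have "u = 0" using a_nonzero by simp
  then show False using nz by (simp add: Rm_simps x)
qed

end


section \<open>From charts to the manifold\<close>

text \<open>A function whose derivative vanishes in every chart is constant, as \<open>M\<close> is connected.\<close>

lemma smooth_function_constant:
  fixes A :: "('m::{t2_space, second_countable_topology}, 'e::euclidean_space) chart set"
  assumes M: "connected_smooth_manifold A" and \<psi>: "smooth_function A \<psi>"
    and zero: "\<And>c x u. c \<in> A \<Longrightarrow> x \<in> chart_image c \<Longrightarrow> dir_deriv (\<psi> \<circ> chart_inv c) x u = 0"
  shows "\<exists>a. \<forall>p. \<psi> p = a"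
proof -
  have "\<forall>\<^sub>F q in at p. \<psi> p = \<psi> q" for p
  proof -
    obtain c where c: "c \<in> A" "p \<in> fst c"
    proof -
      have "p \<in> (\<Union>c\<in>A. fst c)"
        using M by (simp add: connected_smooth_manifold_def smooth_atlas_def)
      then show ?thesis using that by blast
    qed
    then have "open (fst c)" and openI: "open (chart_image c)"
      and hom: "homeomorphism (fst c) (chart_image c) (snd c) (chart_inv c)"
      using M by (auto simp: connected_smooth_manifold_def smooth_atlas_def)
    have "snd c p \<in> chart_image c" using c by (simp add: chart_image_def)
    then obtain e where e: "e > 0" "ball (snd c p) e \<subseteq> chart_image c"
      using openI openE by blast
    define N where "N = fst c \<inter> snd c -` ball (snd c p) e"
    have "open N"
      unfolding N_def
      using continuous_open_preimage[OF homeomorphism_cont1[OF hom] \<open>open (fst c)\<close>] by blast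
    moreover have "p \<in> N" using c e by (simp add: N_def)
    moreover have "\<psi> p = \<psi> q" if "q \<in> N" for q
    proof -
      have d: "((\<psi> \<circ> chart_inv c) has_derivative (\<lambda>_. 0)) (at y within ball (snd c p) e)"
        if "y \<in> ball (snd c p) e" for y
      proof (rule has_derivative_at_withinI)
        have "y \<in> chart_image c" using e that by blast
        moreover have "smooth_on (chart_image c) (\<psi> \<circ> chart_inv c)"
          using \<psi> c(1) by (simp add: smooth_function_def)
        moreover have "dir_deriv (\<psi> \<circ> chart_inv c) y = (\<lambda>_. 0)"
          using zero[OF c(1) \<open>y \<in> chart_image c\<close>] by (simp add: fun_eq_iff)
        ultimately show "((\<psi> \<circ> chart_inv c) has_derivative (\<lambda>_. 0)) (at y)"
          using smooth_on_has_derivative by metis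
      qed
      have "(\<psi> \<circ> chart_inv c) (snd c p) = (\<psi> \<circ> chart_inv c) (snd c q)"
        using e that
        by (intro has_derivative_zero_unique[OF convex_ball[of "snd c p" e] d]) (auto simp: N_def)
      then show ?thesis
        using homeomorphism_apply1[OF hom] c that by (simp add: N_def)
    qed
    ultimately show ?thesis
      unfolding eventually_at_topological by blast
  qed
  then have "\<psi> p = \<psi> q" for p q
    using connected_local_const[of "UNIV :: 'm set" p q \<psi>] M
    by (simp add: connected_smooth_manifold_def)
  then show ?thesis by blast
qed

lemma kaehler_chart_of_kaehler:
  fixes A :: "('m::topological_space, real^'k) chart set"
  assumes "smooth_atlas A" "kaehler A g J" "c \<in> A"
  shows "kaehler_chart (chart_image c) (g c) (J c)"
  using assms
  by (intro kaehler_chart.intro metric_chart.intro kaehler_chart_axioms.intro)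
    (simp_all add: smooth_atlas_def kaehler_def riemannian_metric_def endomorphism_field_def)

theorem proposition2:
  fixes A :: "('m::{t2_space, second_countable_topology}, real^'k) chart set"
    and g :: "('m, real^'k) metric"
    and J :: "('m, real^'k) endofield"
    and f :: "'m \<Rightarrow> real" and lam :: real
    and X :: "('m, real^'k) vfield"
    and n :: nat
  assumes "connected_smooth_manifold A"
    and "CARD('k) = 2 * n" and "2 * n \<ge> 4"
    and "gradient_kaehler_ricci_soliton A g J f lam"
    and "closed_conformal A g X" and "\<not> parallel_field A g X"
  shows "(homothetic A g X \<and> infinitesimal_automorphism A J X) \<and>
    (ricci_flat A g \<and> (2 * n = 4 \<longrightarrow> flat A g))"
proof -
  have atlas: "smooth_atlas A"
    using assms(1) by (simp add: connected_smooth_manifold_def)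
  have K: "kaehler A g J" and f: "smooth_function A f"
    and soliton: "\<And>c x u v. c \<in> A \<Longrightarrow> x \<in> chart_image c \<Longrightarrow>
      ricci (g c) x u v + hessian (g c) (f \<circ> chart_inv c) x u v = lam * g c x u v"
    using assms(4) by (auto simp: gradient_kaehler_ricci_soliton_def)
  obtain \<psi> where X: "vector_field A X" and \<psi>: "conformal_factor A g X \<psi>"
    using assms(5) by (auto simp: closed_conformal_def)
  note kc = kaehler_chart_of_kaehler[OF atlas K]
  have smooth_\<psi>: "smooth_function A \<psi>"
    and conf: "\<And>c x v. c \<in> A \<Longrightarrow> x \<in> chart_image c \<Longrightarrow>
      cov_deriv (g c) (\<lambda>_. v) (X c) x = \<psi> (chart_inv c x) *\<^sub>R v"
    using \<psi> by (auto simp: conformal_factor_def)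
  have smooth_X: "smooth_on (chart_image c) (X c)" if "c \<in> A" for c
    using X that by (simp add: vector_field_def)
  have mc: "metric_chart (chart_image c) (g c)" if "c \<in> A" for c
    using kc[OF that] by (simp add: kaehler_chart_def)
  have "\<exists>a. \<forall>p. \<psi> p = a"
  proof (rule smooth_function_constant[OF assms(1) smooth_\<psi>])
    fix c x u assume c: "c \<in> A" and x: "x \<in> chart_image c"
    interpret kaehler_chart "chart_image c" "g c" "J c" by (rule kc[OF c])
    interpret conformal_chart "chart_image c" "g c" "J c" "X c" "\<psi> \<circ> chart_inv c"
    proof unfold_locales
      show "smooth_on (chart_image c) (\<psi> \<circ> chart_inv c)"
        using smooth_\<psi> c by (simp add: smooth_function_def)
      show "nabla v (X c) y = (\<psi> \<circ> chart_inv c) y *\<^sub>R v" if "y \<in> chart_image c" for y v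
        using conf[OF c that] by (simp add: nabla_def cov_deriv_def)
    qed (use assms(2,3) smooth_X c in auto)
    show "dir_deriv (\<psi> \<circ> chart_inv c) x u = 0"
      by (rule dir_deriv_factor_zero[OF x])
  qed
  then obtain a where a: "\<And>p. \<psi> p = a" by blast
  have "a \<noteq> 0"
    using assms(6) X \<psi> a by (auto simp: parallel_field_def)
  have hc: "homothetic_chart (chart_image c) (g c) (J c) (X c) a" if c: "c \<in> A" for c
  proof -
    interpret kaehler_chart "chart_image c" "g c" "J c" by (rule kc[OF c])
    show ?thesis
    proof unfold_locales
      show "nabla v (X c) y = a *\<^sub>R v" if "y \<in> chart_image c" for y v
        using conf[OF c that] by (simp add: nabla_def cov_deriv_def a)
    qed (use smooth_X c \<open>a \<noteq> 0\<close> in auto)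
  qed
  have "homothetic A g X"
    using X \<psi> a by (auto simp: homothetic_def)
  moreover have "infinitesimal_automorphism A J X"
    unfolding infinitesimal_automorphism_def
    by (intro ballI allI) (rule homothetic_chart.lie_deriv_J[OF hc])
  moreover have Ric: "metric_chart.Ric (g c) x v w = 0" if c: "c \<in> A" and x: "x \<in> chart_image c" for c x v w
  proof -
    interpret homothetic_chart "chart_image c" "g c" "J c" "X c" a by (rule hc[OF c])
    show ?thesis
      using f soliton[OF c] c x
      by (intro soliton_Ric_zero[where f = "f \<circ> chart_inv c" and lam = lam])
        (simp_all add: smooth_function_def ricci_eq_Ric)
  qed
  moreover have "ricci_flat A g"
    unfolding ricci_flat_def
    by (intro ballI allI) (simp add: metric_chart.ricci_eq_Ric[OF mc] Ric)
  moreover have "flat A g" if "2 * n = 4"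
    unfolding flat_def
  proof (intro ballI allI)
    fix c x u v w assume c: "c \<in> A" and x: "x \<in> chart_image c"
    interpret homothetic_chart "chart_image c" "g c" "J c" "X c" a by (rule hc[OF c])
    show "curvature (g c) x u v w = 0"
      using Rm_zero[OF x _ Ric[OF c]] assms(2) that by (simp add: curvature_eq_Rm x)
  qed
  ultimately show ?thesis by blast
qed

end
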